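(* For every $k\in\mathbb{N}$ and any $d\ge 2$, there exists a linear map $P:\mathcal{M}_d\to\mathcal{M}_d$ such that: (1) $P$ is not entanglement breaking; (2) $P$ is $k$-entanglement annihilating.
   Context: $\mathcal{M}_d$ is the set of complex $d\times d$ matrices and $\mathsf{PSD}(\mathbb{C}^d)\subset\mathcal{M}_d$ the cone of positive semidefinite matrices. Set $\mathsf{PSD}(\mathbb{C}^{m})\otimes_{\min}\mathsf{PSD}(\mathbb{C}^{n})=\mathrm{conv}\{x\otimes y: x\in\mathsf{PSD}(\mathbb{C}^m),y\in\mathsf{PSD}(\mathbb{C}^n)\}$ and $\mathsf{PSD}(\mathbb{C}^{d})^{\otimes_{\min}k}=\mathrm{conv}\{x_1\otimes\cdots\otimes x_k: x_1,\dots,x_k\in\mathsf{PSD}(\mathbb{C}^d)\}$. Let $\mathsf{PSD}(\mathbb{C}^{d})^{\otimes_{\max}k}=(\mathsf{PSD}(\mathbb{C}^{d})^{\otimes_{\min}k})^*$, the dual cone taken with respect to the Hilbert–Schmidt inner product $\langle x,y\rangle=\mathrm{Tr}[xy]$ on the real space of self-adjoint elements of $\mathcal{M}_d^{\otimes k}$. A linear map $P:\mathcal{M}_d\to\mathcal{M}_d$ is entanglement breaking if $(\mathrm{id}_n\otimes P)(\mathsf{PSD}(\mathbb{C}^n\otimes\mathbb{C}^d))\subseteq\mathsf{PSD}(\mathbb{C}^n)\otimes_{\min}\mathsf{PSD}(\mathbb{C}^d)$ for every $n\in\mathbb{N}$. It is $k$-entanglement annihilating if $P^{\otimes k}(\mathsf{PSD}(\mathbb{C}^d)^{\otimes_{\max}k})\subseteq\mathsf{PSD}(\mathbb{C}^d)^{\otimes_{\min}k}$.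 *)

theory Defs
  imports "Jordan_Normal_Form.Schur_Decomposition" "Jordan_Normal_Form.VS_Connect"
begin

definition hermitian_mats :: "nat \<Rightarrow> complex mat set" where
  "hermitian_mats N = {A \<in> carrier_mat N N. mat_adjoint A = A}"

definition psd_mats :: "nat \<Rightarrow> complex mat set" where
  "psd_mats N = {A \<in> hermitian_mats N. \<forall>v \<in> carrier_vec N. 0 \<le> (A *\<^sub>v v) \<bullet>c v}"

definition mat_trace :: "complex mat \<Rightarrow> complex" where
  "mat_trace A = (\<Sum>i<dim_row A. A $$ (i, i))"

text \<open>The type \<open>complex mat\<close> is not an instance of \<open>real_vector\<close>; the following two
  definitions repeat those of \<open>convex\<close> and \<open>convex hull\<close> for it.\<close>

definition mat_convex :: "complex mat set \<Rightarrow> bool" where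
  "mat_convex C \<longleftrightarrow> (\<forall>A\<in>C. \<forall>B\<in>C. \<forall>u v :: real. 0 \<le> u \<longrightarrow> 0 \<le> v \<longrightarrow> u + v = 1 \<longrightarrow>
     complex_of_real u \<cdot>\<^sub>m A + complex_of_real v \<cdot>\<^sub>m B \<in> C)"

definition mat_conv :: "complex mat set \<Rightarrow> complex mat set" where
  "mat_conv S = mat_convex hull S"

text \<open>\<open>\<complex>\<^sup>m \<otimes> \<complex>\<^sup>n\<close> is identified with \<open>\<complex>\<^sup>m\<^sup>n\<close> by sending \<open>e\<^sub>i \<otimes> e\<^sub>p\<close> to the basis vector with
  index \<open>i * n + p\<close> (indices starting at 0).\<close>

definition kron :: "complex mat \<Rightarrow> complex mat \<Rightarrow> complex mat" where
  "kron A B = mat (dim_row A * dim_row B) (dim_col A * dim_col B)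
     (\<lambda>(r, s). A $$ (r div dim_row B, s div dim_col B) * B $$ (r mod dim_row B, s mod dim_col B))"

definition kron_list :: "complex mat list \<Rightarrow> complex mat" where
  "kron_list xs = foldr kron xs (1\<^sub>m 1)"

definition psd_min_tensor :: "nat \<Rightarrow> nat \<Rightarrow> complex mat set" where
  "psd_min_tensor m n = mat_conv {kron x y | x y. x \<in> psd_mats m \<and> y \<in> psd_mats n}"

definition psd_min_power :: "nat \<Rightarrow> nat \<Rightarrow> complex mat set" where
  "psd_min_power d k = mat_conv {kron_list xs | xs. length xs = k \<and> set xs \<subseteq> psd_mats d}"

text \<open>The trace of a product of two self-adjoint matrices is real, so the order on
  \<open>complex\<close> (which compares real parts and requires equal imaginary parts) adds nothing here.\<close>

definition dual_cone :: "nat \<Rightarrow> complex mat set \<Rightarrow> complex mat set" where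
  "dual_cone N C = {X \<in> hermitian_mats N. \<forall>Y\<in>C. 0 \<le> mat_trace (X * Y)}"

definition psd_max_power :: "nat \<Rightarrow> nat \<Rightarrow> complex mat set" where
  "psd_max_power d k = dual_cone (d ^ k) (psd_min_power d k)"

definition mat_unit :: "nat \<Rightarrow> nat \<Rightarrow> nat \<Rightarrow> complex mat" where
  "mat_unit N i j = mat N N (\<lambda>(r, s). if r = i \<and> s = j then 1 else 0)"

text \<open>For linear \<open>F\<close> on \<open>m \<times> m\<close> matrices and linear \<open>G\<close> on \<open>n \<times> n\<close> matrices, this is \<open>F \<otimes> G\<close>:
  the linear extension of \<open>E\<^sub>i\<^sub>j \<otimes> E\<^sub>p\<^sub>q \<mapsto> F E\<^sub>i\<^sub>j \<otimes> G E\<^sub>p\<^sub>q\<close>, where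
  \<open>E\<^sub>i\<^sub>j \<otimes> E\<^sub>p\<^sub>q\<close> is the matrix unit with index \<open>(i * n + p, j * n + q)\<close>.\<close>

definition map_tensor :: "nat \<Rightarrow> nat \<Rightarrow> (complex mat \<Rightarrow> complex mat) \<Rightarrow>
    (complex mat \<Rightarrow> complex mat) \<Rightarrow> complex mat \<Rightarrow> complex mat" where
  "map_tensor m n F G X = mat (m * n) (m * n) (\<lambda>(r, s).
     \<Sum>i<m. \<Sum>j<m. \<Sum>p<n. \<Sum>q<n.
       X $$ (i * n + p, j * n + q) * kron (F (mat_unit m i j)) (G (mat_unit n p q)) $$ (r, s))"

primrec map_tensor_power :: "nat \<Rightarrow> (complex mat \<Rightarrow> complex mat) \<Rightarrow> nat \<Rightarrow> complex mat \<Rightarrow> complex mat"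
  where
    "map_tensor_power d P 0 = (\<lambda>X. X)"
  | "map_tensor_power d P (Suc k) = map_tensor d (d ^ k) P (map_tensor_power d P k)"

definition linear_mat_map :: "nat \<Rightarrow> (complex mat \<Rightarrow> complex mat) \<Rightarrow> bool" where
  "linear_mat_map d P \<longleftrightarrow>
     linear_map class_ring (module_mat TYPE(complex) d d) (module_mat TYPE(complex) d d) P"

definition entanglement_breaking :: "nat \<Rightarrow> (complex mat \<Rightarrow> complex mat) \<Rightarrow> bool" where
  "entanglement_breaking d P \<longleftrightarrow>
     (\<forall>n\<ge>1. map_tensor n d (\<lambda>X. X) P ` psd_mats (n * d) \<subseteq> psd_min_tensor n d)"

definition entanglement_annihilating :: "nat \<Rightarrow> nat \<Rightarrow> (complex mat \<Rightarrow> complex mat) \<Rightarrow> bool" where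
  "entanglement_annihilating k d P \<longleftrightarrow>
     map_tensor_power d P k ` psd_max_power d k \<subseteq> psd_min_power d k"

end

theory Submission
  imports Defs
begin

text \<open>Let \<open>B\<close> be the projection onto two basis vectors. The map \<open>P\<^sub>0 X = Tr X 1 + B X B\<close> is a sum
  \<open>\<Sum>\<^sub>l Tr (p\<^sub>l X) q\<^sub>l\<close> with \<open>p\<^sub>l, q\<^sub>l\<close> positive semidefinite, and it lies on the boundary of the
  entanglement breaking maps: \<open>P X = Tr X 1 + (1 + e) B X B\<close> violates the partial transpose test for
  every \<open>e > 0\<close>. Since \<open>P = (1 + e) P\<^sub>0 - e Tr(\<cdot>) 1\<close>, the tensor powers satisfy
  \<open>P\<^sup>k\<^sup>+\<^sup>1 X = (1 + e) \<Sum>\<^sub>l q\<^sub>l \<otimes> P\<^sup>k (X\<^sub>l) - e 1 \<otimes> P\<^sup>k (X\<^sub>1)\<close>, where \<open>X\<^sub>l\<close> and \<open>X\<^sub>1\<close> arise from \<open>X\<close> by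
  contracting the first factor with \<open>p\<^sub>l\<close> and \<open>1\<close>. As \<open>Tr Y 1 \<le> P\<^sub>0 Y \<le> 2 Tr Y 1\<close> for positive semidefinite
  \<open>Y\<close>, induction on \<open>k\<close> gives \<open>(1 - e 4\<^sup>k) Tr X 1 \<le> P\<^sup>k X \<le> 4\<^sup>k Tr X 1\<close> in the order of the cone of fully
  separable matrices for every block-positive \<open>X\<close>; then \<open>e = 4\<^sup>-\<^sup>k\<close> works.\<close>

section \<open>Positive semidefinite matrices\<close>

text \<open>Test vectors are index functions instead of \<open>vec\<close>s, so a vector with
  prescribed coordinates is just a lambda term. Values at indices from \<open>n\<close> on are never
  read.\<close>

definition qform :: "nat \<Rightarrow> complex mat \<Rightarrow> (nat \<Rightarrow> complex) \<Rightarrow> complex" where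
  "qform n A v = (\<Sum>r<n. \<Sum>s<n. A $$ (r, s) * v s * cnj (v r))"

lemma mult_vec_cscalar_prod:
  assumes "A \<in> carrier_mat n n"
  shows "(A *\<^sub>v vec n v) \<bullet>c vec n v = qform n A v"
  using assms
  by (auto simp: qform_def scalar_prod_def atLeast0LessThan sum_distrib_left sum_distrib_right mult_ac
      intro!: sum.cong)

lemma psd_qform: "A \<in> psd_mats n \<Longrightarrow> 0 \<le> qform n A v"
  using mult_vec_cscalar_prod[of A n v]
  by (auto simp: psd_mats_def hermitian_mats_def dest: bspec[of _ _ "vec n v"])

text \<open>Polarization, the adjugate comparison and the determinant bound all use test vectors
  with at most two nonzero coordinates.\<close>

lemma qform_supp2:
  assumes "r < n" "s < n" "r \<noteq> s" and v: "\<And>i. i < n \<Longrightarrow> i \<noteq> r \<Longrightarrow> i \<noteq> s \<Longrightarrow> v i = 0"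
  shows "qform n A v = A $$ (r, r) * v r * cnj (v r) + A $$ (r, s) * v s * cnj (v r)
     + A $$ (s, r) * v r * cnj (v s) + A $$ (s, s) * v s * cnj (v s)"
proof -
  have *: "(\<Sum>i<n. f i) = f r + f s" if "\<And>i. i < n \<Longrightarrow> i \<noteq> r \<Longrightarrow> i \<noteq> s \<Longrightarrow> f i = 0" for f :: "nat \<Rightarrow> complex"
  proof -
    have "(\<Sum>i<n. f i) = (\<Sum>i\<in>{r, s}. f i)"
      using assms that by (intro sum.mono_neutral_right) auto
    then show ?thesis using \<open>r \<noteq> s\<close> by simp
  qed
  show ?thesis unfolding qform_def by (subst *; simp add: v *)
qed

lemma qform_supp1:
  assumes "r < n" and v: "\<And>i. i < n \<Longrightarrow> i \<noteq> r \<Longrightarrow> v i = 0"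
  shows "qform n A v = A $$ (r, r) * v r * cnj (v r)"
proof -
  have *: "(\<Sum>i<n. f i) = f r" if "\<And>i. i < n \<Longrightarrow> i \<noteq> r \<Longrightarrow> f i = 0" for f :: "nat \<Rightarrow> complex"
  proof -
    have "(\<Sum>i<n. f i) = (\<Sum>i\<in>{r}. f i)"
      using assms that by (intro sum.mono_neutral_right) auto
    then show ?thesis by simp
  qed
  show ?thesis unfolding qform_def by (subst *; simp add: v *)
qed

lemma psd_diag_nonneg: "A \<in> psd_mats n \<Longrightarrow> r < n \<Longrightarrow> 0 \<le> A $$ (r, r)"
  using psd_qform[of A n "\<lambda>i. if i = r then 1 else 0"] by (simp add: qform_supp1[of r])

text \<open>Over the complex numbers positivity of the quadratic form already forces hermiticity
  (polarization).\<close>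

lemma psdI:
  assumes A: "A \<in> carrier_mat n n" and q: "\<And>v. 0 \<le> qform n A v"
  shows "A \<in> psd_mats n"
proof -
  have diag: "0 \<le> A $$ (r, r)" if "r < n" for r
    using q[of "\<lambda>i. if i = r then 1 else 0"] that by (simp add: qform_supp1[of r])
  have herm: "A $$ (s, r) = cnj (A $$ (r, s))" if rs: "r < n" "s < n" for r s
  proof (cases "r = s")
    case True
    then show ?thesis using diag[OF rs(1)] by (simp add: complex_eq_iff less_eq_complex_def)
  next
    case False
    \<comment> \<open>The form is real at both test vectors. At \<open>e_r + e_s\<close> this makes
      the imaginary parts of the two off-diagonal entries opposite; at \<open>e_r + i e_s\<close> it
      makes their real parts equal.\<close>
    have 1: "0 \<le> A $$ (r, r) + A $$ (r, s) + A $$ (s, r) + A $$ (s, s)"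
      using q[of "\<lambda>i. if i = r \<or> i = s then 1 else 0"] rs False by (simp add: qform_supp2[of r _ s])
    have 2: "0 \<le> A $$ (r, r) + A $$ (r, s) * \<i> + A $$ (s, r) * cnj \<i> + A $$ (s, s)"
      using q[of "\<lambda>i. if i = r then 1 else if i = s then \<i> else 0"] rs False
      by (simp add: qform_supp2[of r _ s] mult.assoc)
    show ?thesis using 1 2 diag[OF rs(1)] diag[OF rs(2)]
      by (simp add: complex_eq_iff less_eq_complex_def)
  qed
  have "mat_adjoint A = A"
    using A herm[symmetric] by (intro eq_matI) (auto simp: mat_adjoint_def mat_of_rows_def)
  moreover have "0 \<le> (A *\<^sub>v v) \<bullet>c v" if "v \<in> carrier_vec n" for v
  proof -
    have "v = vec n (\<lambda>i. v $ i)" using that by auto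
    then show ?thesis using mult_vec_cscalar_prod[OF A, of "\<lambda>i. v $ i"] q by metis
  qed
  ultimately show ?thesis using A by (auto simp: psd_mats_def hermitian_mats_def)
qed

lemma psd_carrier: "A \<in> psd_mats n \<Longrightarrow> A \<in> carrier_mat n n"
  by (auto simp: psd_mats_def hermitian_mats_def)

lemma psd_hermitian:
  assumes "A \<in> psd_mats n" "r < n" "s < n"
  shows "A $$ (s, r) = cnj (A $$ (r, s))"
proof -
  have "A = mat_adjoint A" "A \<in> carrier_mat n n"
    using assms by (auto simp: psd_mats_def hermitian_mats_def)
  then have "A $$ (s, r) = mat_adjoint A $$ (s, r)" by simp
  also have "\<dots> = cnj (A $$ (r, s))"
    using assms \<open>A \<in> carrier_mat n n\<close> by (auto simp: mat_adjoint_def mat_of_rows_def)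
  finally show ?thesis .
qed

lemma complex_mult_nonneg: "0 \<le> (a::complex) \<Longrightarrow> 0 \<le> b \<Longrightarrow> 0 \<le> a * b"
  by (simp add: less_eq_complex_def)

lemma complex_sum_nonneg:
  fixes f :: "'a \<Rightarrow> complex"
  shows "(\<And>x. x \<in> S \<Longrightarrow> 0 \<le> f x) \<Longrightarrow> 0 \<le> sum f S"
  by (auto simp: less_eq_complex_def intro: sum_nonneg)

lemma psd_add:
  assumes "A \<in> psd_mats n" "B \<in> psd_mats n"
  shows "A + B \<in> psd_mats n"
proof (rule psdI)
  have c: "A \<in> carrier_mat n n" "B \<in> carrier_mat n n" using assms psd_carrier by auto
  then show "A + B \<in> carrier_mat n n" by simp
  fix v
  have "qform n (A + B) v = qform n A v + qform n B v"
    using c by (simp add: qform_def sum.distrib ring_distribs)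
  then show "0 \<le> qform n (A + B) v"
    using assms psd_qform[of _ n v] by (simp add: less_eq_complex_def)
qed

lemma psd_smult:
  assumes "A \<in> psd_mats n" "0 \<le> c"
  shows "c \<cdot>\<^sub>m A \<in> psd_mats n"
proof (rule psdI)
  have c: "A \<in> carrier_mat n n" using assms psd_carrier by auto
  then show "c \<cdot>\<^sub>m A \<in> carrier_mat n n" by simp
  fix v
  have "qform n (c \<cdot>\<^sub>m A) v = c * qform n A v"
    using c by (simp add: qform_def sum_distrib_left mult_ac)
  then show "0 \<le> qform n (c \<cdot>\<^sub>m A) v"
    using assms psd_qform[of _ n v] by (simp add: complex_mult_nonneg)
qed

section \<open>Rank-one matrices and diagonal projections\<close>

definition rank1 :: "nat \<Rightarrow> (nat \<Rightarrow> complex) \<Rightarrow> complex mat" where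
  "rank1 n v = mat n n (\<lambda>(r, s). v r * cnj (v s))"

lemma cnj_mult_nonneg: "0 \<le> cnj z * z"
  by (simp add: less_eq_complex_def)

lemma psd_rank1: "rank1 n w \<in> psd_mats n"
proof (rule psdI)
  fix v
  have "qform n (rank1 n w) v = (\<Sum>r<n. w r * cnj (v r)) * (\<Sum>s<n. cnj (w s) * v s)"
    unfolding sum_product by (simp add: qform_def rank1_def mult_ac)
  also have "\<dots> = cnj (\<Sum>s<n. cnj (w s) * v s) * (\<Sum>s<n. cnj (w s) * v s)"
    by simp
  finally show "0 \<le> qform n (rank1 n w) v" by (metis cnj_mult_nonneg)
qed (simp add: rank1_def)

definition diag_proj :: "nat \<Rightarrow> nat set \<Rightarrow> complex mat" where
  "diag_proj n S = mat n n (\<lambda>(r, s). if r = s \<and> r \<in> S then 1 else 0)"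

lemma psd_diag_proj: "diag_proj n S \<in> psd_mats n"
proof (rule psdI)
  fix v
  have "qform n (diag_proj n S) v = (\<Sum>r<n. \<Sum>s<n. if s = r then (if r \<in> S then cnj (v r) * v r else 0) else 0)"
    unfolding qform_def diag_proj_def by (intro sum.cong refl) auto
  also have "\<dots> = (\<Sum>r<n. if r \<in> S then cnj (v r) * v r else 0)"
    by (simp add: sum.delta)
  also have "0 \<le> \<dots>" by (intro complex_sum_nonneg) (auto simp: cnj_mult_nonneg)
  finally show "0 \<le> qform n (diag_proj n S) v" .
qed (simp add: diag_proj_def)

lemma diag_proj_UNIV: "diag_proj n UNIV = 1\<^sub>m n"
  by (auto simp: diag_proj_def)

lemma psd_one: "1\<^sub>m n \<in> psd_mats n"
  using psd_diag_proj[of n UNIV] by (simp add: diag_proj_UNIV)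

section \<open>Tensor products and the cone of fully separable matrices\<close>

lemma sum_mult_index:
  fixes f :: "nat \<Rightarrow> 'a::comm_monoid_add"
  shows "(\<Sum>r<d * N. f r) = (\<Sum>i<d. \<Sum>a<N. f (i * N + a))"
proof -
  have "sum f {..<d * N} = (\<Sum>i<d. sum f {i * N..<i * N + N})"
    by (rule sum.nat_group[symmetric])
  also have "\<dots> = (\<Sum>i<d. \<Sum>a<N. f (i * N + a))"
  proof (rule sum.cong[OF refl])
    fix i
    show "sum f {i * N..<i * N + N} = (\<Sum>a<N. f (i * N + a))"
      using sum.shift_bounds_nat_ivl[of f 0 "i * N" N] by (simp add: atLeast0LessThan add.commute)
  qed
  finally show ?thesis .
qed

lemma mult_index_less:
  assumes "i < d" "a < N"
  shows "i * N + a < d * (N::nat)"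
proof -
  have "i * N + a < Suc i * N" using assms by simp
  also have "\<dots> \<le> d * N" using assms by (intro mult_le_mono1) simp
  finally show ?thesis .
qed

lemma div_less_mod_less:
  assumes "r < d * (N::nat)"
  shows "r div N < d" "r mod N < N"
  using assms by (auto simp: less_mult_imp_div_less intro!: mod_less_divisor gr0I)

lemma kron_carrier [simp]:
  "A \<in> carrier_mat m m' \<Longrightarrow> B \<in> carrier_mat n n' \<Longrightarrow> kron A B \<in> carrier_mat (m * n) (m' * n')"
  by (auto simp: kron_def)

lemma kron_index:
  assumes "A \<in> carrier_mat m m" "B \<in> carrier_mat n n" "r < m * n" "s < m * n"
  shows "kron A B $$ (r, s) = A $$ (r div n, s div n) * B $$ (r mod n, s mod n)"
  using assms by (auto simp: kron_def)

lemma kron_index':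
  assumes "A \<in> carrier_mat m m" "B \<in> carrier_mat n n" "i < m" "j < m" "a < n" "b < n"
  shows "kron A B $$ (i * n + a, j * n + b) = A $$ (i, j) * B $$ (a, b)"
  using assms by (simp add: kron_index mult_index_less)

lemma kron_list_Nil [simp]: "kron_list [] = 1\<^sub>m 1"
  and kron_list_Cons [simp]: "kron_list (x # xs) = kron x (kron_list xs)"
  by (simp_all add: kron_list_def)

lemma kron_list_carrier:
  "set xs \<subseteq> carrier_mat d d \<Longrightarrow> kron_list xs \<in> carrier_mat (d ^ length xs) (d ^ length xs)"
  by (induction xs) auto

lemma kron_list_psd_carrier:
  assumes "set xs \<subseteq> psd_mats d" "length xs = k"
  shows "kron_list xs \<in> carrier_mat (d ^ k) (d ^ k)"
  using kron_list_carrier[of xs d] assms psd_carrier by auto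

lemma kron_list_replicate_one: "kron_list (replicate k (1\<^sub>m d)) = 1\<^sub>m (d ^ k)"
proof (induction k)
  case (Suc k)
  show ?case
  proof (rule eq_matI)
    fix r s assume rs: "r < dim_row (1\<^sub>m (d ^ Suc k) :: complex mat)" "s < dim_col (1\<^sub>m (d ^ Suc k) :: complex mat)"
    then have *: "r < d * d ^ k" "s < d * d ^ k" by auto
    have "r div d ^ k = s div d ^ k \<and> r mod d ^ k = s mod d ^ k \<longleftrightarrow> r = s"
      by (metis div_mult_mod_eq)
    then show "kron_list (replicate (Suc k) (1\<^sub>m d)) $$ (r, s) = 1\<^sub>m (d ^ Suc k) $$ (r, s)"
      using rs div_less_mod_less[OF *(1)] div_less_mod_less[OF *(2)]
      by (auto simp: Suc.IH kron_index[OF one_carrier_mat one_carrier_mat *])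
  qed (simp_all add: Suc.IH kron_def)
qed simp

text \<open>The convex cone generated by product matrices, built one generator at a time so that
  closure properties follow by rule induction. The coefficient \<open>c\<close> is complex, and
  \<open>0 \<le> c\<close> makes it real.\<close>

inductive_set sep :: "nat \<Rightarrow> nat \<Rightarrow> complex mat set" for d k where
  zero: "0\<^sub>m (d ^ k) (d ^ k) \<in> sep d k"
| step: "A \<in> sep d k \<Longrightarrow> 0 \<le> c \<Longrightarrow> length xs = k \<Longrightarrow> set xs \<subseteq> psd_mats d \<Longrightarrow>
    A + c \<cdot>\<^sub>m kron_list xs \<in> sep d k"

lemma sep_carrier: "A \<in> sep d k \<Longrightarrow> A \<in> carrier_mat (d ^ k) (d ^ k)"
  by (induction rule: sep.induct) (auto dest!: kron_list_psd_carrier)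

lemma sep_generator:
  assumes "length xs = k" "set xs \<subseteq> psd_mats d"
  shows "kron_list xs \<in> sep d k"
proof -
  have "0\<^sub>m (d ^ k) (d ^ k) + 1 \<cdot>\<^sub>m kron_list xs = kron_list xs"
    using kron_list_psd_carrier[OF assms(2,1)] by (intro eq_matI) auto
  then show ?thesis using sep.step[OF sep.zero _ assms, of 1] by (simp add: less_eq_complex_def)
qed

lemma sep_add:
  assumes "A \<in> sep d k" "B \<in> sep d k"
  shows "A + B \<in> sep d k"
  using assms(2)
proof (induction rule: sep.induct)
  case zero
  then show ?case using assms(1) sep_carrier by simp
next
  case (step B c xs)
  have "A + (B + c \<cdot>\<^sub>m kron_list xs) = (A + B) + c \<cdot>\<^sub>m kron_list xs"
    using step.hyps assms(1)
    by (intro assoc_add_mat[symmetric, of _ "d ^ k" "d ^ k"])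
       (auto simp: sep_carrier kron_list_psd_carrier)
  then show ?case using step sep.step by simp
qed

lemma sep_smult:
  assumes "A \<in> sep d k" "0 \<le> a"
  shows "a \<cdot>\<^sub>m A \<in> sep d k"
  using assms(1)
proof (induction rule: sep.induct)
  case zero
  then show ?case by (simp add: sep.zero)
next
  case (step B c xs)
  have "a \<cdot>\<^sub>m (B + c \<cdot>\<^sub>m kron_list xs) = a \<cdot>\<^sub>m B + (a * c) \<cdot>\<^sub>m kron_list xs"
    using sep_carrier[OF step.hyps(1)] kron_list_psd_carrier[OF step.hyps(4,3)]
    by (intro eq_matI) (auto simp: algebra_simps)
  then show ?case using step assms(2) sep.step complex_mult_nonneg by simp
qed

lemma sep_sum:
  assumes "finite L" "\<And>l. l \<in> L \<Longrightarrow> A l \<in> sep d k"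
  shows "mat (d ^ k) (d ^ k) (\<lambda>(r, s). \<Sum>l\<in>L. A l $$ (r, s)) \<in> sep d k"
  using assms
proof (induction L rule: finite_induct)
  case empty
  have "mat (d ^ k) (d ^ k) (\<lambda>(r, s). \<Sum>l\<in>{}. A l $$ (r, s)) = 0\<^sub>m (d ^ k) (d ^ k)"
    by (intro eq_matI) auto
  then show ?case using sep.zero by metis
next
  case (insert x L)
  have "mat (d ^ k) (d ^ k) (\<lambda>(r, s). \<Sum>l\<in>insert x L. A l $$ (r, s)) =
     A x + mat (d ^ k) (d ^ k) (\<lambda>(r, s). \<Sum>l\<in>L. A l $$ (r, s))"
    using insert sep_carrier[of "A x" d k] by (intro eq_matI) auto
  moreover have "A x + mat (d ^ k) (d ^ k) (\<lambda>(r, s). \<Sum>l\<in>L. A l $$ (r, s)) \<in> sep d k"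
    by (intro sep_add insert) auto
  ultimately show ?case by metis
qed

text \<open>\<open>kron x\<close> is linear and sends the generator of \<open>xs\<close> to the
  generator of \<open>x # xs\<close>. This carries separability from \<open>k\<close> to
  \<open>k + 1\<close> factors.\<close>

lemma sep_kron:
  assumes x: "x \<in> psd_mats d" and A: "A \<in> sep d k"
  shows "kron x A \<in> sep d (Suc k)"
  using A
proof (induction rule: sep.induct)
  case zero
  have "kron x (0\<^sub>m (d ^ k) (d ^ k)) = 0\<^sub>m (d ^ Suc k) (d ^ Suc k)"
    using psd_carrier[OF x]
    by (intro eq_matI) (auto simp: kron_def div_less_mod_less)
  then show ?case by (metis sep.zero)
next
  case (step B c xs)
  note c = psd_carrier[OF x] sep_carrier[OF step.hyps(1)] kron_list_psd_carrier[OF step.hyps(4,3)]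
  have "kron x (B + c \<cdot>\<^sub>m kron_list xs) = kron x B + c \<cdot>\<^sub>m kron_list (x # xs)"
    using c by (intro eq_matI) (auto simp: kron_def div_less_mod_less algebra_simps)
  moreover have "kron x B + c \<cdot>\<^sub>m kron_list (x # xs) \<in> sep d (Suc k)"
    using step x by (intro sep.step) auto
  ultimately show ?case by simp
qed

section \<open>Convex hulls and their relation to the cone \<open>sep\<close>\<close>

lemma mat_conv_subset: "S \<subseteq> mat_conv S"
  by (simp add: mat_conv_def hull_subset)

lemma mat_convex_mat_conv: "mat_convex (mat_conv S)"
  unfolding mat_conv_def hull_def mat_convex_def by blast

lemma mat_conv_minimal: "S \<subseteq> T \<Longrightarrow> mat_convex T \<Longrightarrow> mat_conv S \<subseteq> T"
  unfolding mat_conv_def by (rule hull_minimal)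

text \<open>The matrices whose multiple by \<open>c\<close> lies in the hull form a convex set
  containing \<open>S\<close>, hence containing the hull.\<close>

lemma mat_conv_smult:
  assumes "\<And>A. A \<in> S \<Longrightarrow> c \<cdot>\<^sub>m A \<in> S" "S \<subseteq> carrier_mat n n" "A \<in> mat_conv S"
  shows "c \<cdot>\<^sub>m A \<in> mat_conv S"
proof -
  let ?T = "{A \<in> carrier_mat n n. c \<cdot>\<^sub>m A \<in> mat_conv S}"
  have "mat_convex ?T"
    unfolding mat_convex_def
  proof (intro ballI allI impI)
    fix A B and u v :: real
    assume *: "A \<in> ?T" "B \<in> ?T" "0 \<le> u" "0 \<le> v" "u + v = 1"
    have "c \<cdot>\<^sub>m (complex_of_real u \<cdot>\<^sub>m A + complex_of_real v \<cdot>\<^sub>m B) =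
       complex_of_real u \<cdot>\<^sub>m (c \<cdot>\<^sub>m A) + complex_of_real v \<cdot>\<^sub>m (c \<cdot>\<^sub>m B)"
      using * by (intro eq_matI) (auto simp: algebra_simps)
    also have "\<dots> \<in> mat_conv S"
      using * mat_convex_mat_conv[of S] unfolding mat_convex_def by blast
    finally show "complex_of_real u \<cdot>\<^sub>m A + complex_of_real v \<cdot>\<^sub>m B \<in> ?T" using * by simp
  qed
  moreover have "S \<subseteq> ?T" using assms(1,2) mat_conv_subset by auto
  ultimately show ?thesis using mat_conv_minimal[of S ?T] assms(3) by blast
qed

text \<open>For \<open>k = 0\<close> this fails, as \<open>psd_min_power d 0\<close> is the singleton of the \<open>1 \<times> 1\<close> identity.\<close>

lemma sep_subset_psd_min_power:
  assumes "k \<ge> 1"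
  shows "sep d k \<subseteq> psd_min_power d k"
proof
  let ?S = "{kron_list xs | xs. length xs = k \<and> set xs \<subseteq> psd_mats d}"
  let ?N = "d ^ k"
  have S: "?S \<subseteq> carrier_mat ?N ?N" using kron_list_psd_carrier by auto
  \<comment> \<open>The scalar is absorbed into the first tensor factor, which exists because
    \<open>k \<ge> 1\<close>.\<close>
  have scale: "c \<cdot>\<^sub>m A \<in> ?S" if "A \<in> ?S" "0 \<le> c" for c A
  proof -
    from that(1) obtain ys where ys: "A = kron_list ys" "length ys = k" "set ys \<subseteq> psd_mats d"
      by auto
    then obtain x xs where "ys = x # xs" using assms by (cases ys) auto
    note A = ys[unfolded this]
    have "c \<cdot>\<^sub>m A = kron_list ((c \<cdot>\<^sub>m x) # xs)"
      unfolding A(1) using A(3) psd_carrier[of x d] kron_list_psd_carrier[of xs d "length xs"]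
      by (intro eq_matI) (auto simp: kron_def div_less_mod_less)
    moreover have "c \<cdot>\<^sub>m x \<in> psd_mats d" using A that psd_smult by auto
    ultimately show ?thesis using A by (intro CollectI exI[of _ "(c \<cdot>\<^sub>m x) # xs"]) auto
  qed
  fix A assume "A \<in> sep d k"
  then show "A \<in> psd_min_power d k"
  proof (induction rule: sep.induct)
    case zero
    have "kron_list (replicate k (1\<^sub>m d)) \<in> ?S" using psd_one by auto
    from scale[OF this, of 0] have "0 \<cdot>\<^sub>m 1\<^sub>m ?N \<in> ?S"
      unfolding kron_list_replicate_one by simp
    moreover have "0 \<cdot>\<^sub>m 1\<^sub>m ?N = (0\<^sub>m ?N ?N :: complex mat)"
      by (intro eq_matI) auto
    ultimately have "0\<^sub>m ?N ?N \<in> ?S" by metis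
    then show ?case unfolding psd_min_power_def by (rule subsetD[OF mat_conv_subset])
  next
    case (step A c xs)
    have two: "0 \<le> (2::complex)" "0 \<le> 2 * c" using step.hyps by (simp_all add: less_eq_complex_def)
    have 1: "2 \<cdot>\<^sub>m A \<in> mat_conv ?S"
      by (rule mat_conv_smult[OF scale[OF _ two(1)] S step.IH[unfolded psd_min_power_def]])
    have "kron_list xs \<in> ?S" using step.hyps by blast
    then have 2: "(2 * c) \<cdot>\<^sub>m kron_list xs \<in> mat_conv ?S"
      by (intro subsetD[OF mat_conv_subset] scale two(2))
    \<comment> \<open>A sum is the midpoint of the doubled summands, and doubling stays inside the
      hull.\<close>
    have "A + c \<cdot>\<^sub>m kron_list xs = complex_of_real (1/2) \<cdot>\<^sub>m (2 \<cdot>\<^sub>m A) + complex_of_real (1/2) \<cdot>\<^sub>m ((2 * c) \<cdot>\<^sub>m kron_list xs)"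
      using sep_carrier[OF step.hyps(1)] kron_list_psd_carrier[OF step.hyps(4,3)]
      by (intro eq_matI) auto
    also have "\<dots> \<in> mat_conv ?S"
      by (rule mat_convex_mat_conv[unfolded mat_convex_def, rule_format, OF 1 2]) auto
    finally show ?case unfolding psd_min_power_def .
  qed
qed

section \<open>Slices of block-positive matrices\<close>

text \<open>Records only the trace inequalities against product matrices, which pass directly to
  slices and so support induction on \<open>k\<close>.\<close>

definition blockpos :: "nat \<Rightarrow> nat \<Rightarrow> complex mat set" where
  "blockpos d k = {X \<in> carrier_mat (d ^ k) (d ^ k).
     \<forall>xs. length xs = k \<and> set xs \<subseteq> psd_mats d \<longrightarrow> 0 \<le> mat_trace (X * kron_list xs)}"

lemma psd_max_power_subset_blockpos: "psd_max_power d k \<subseteq> blockpos d k"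
proof
  fix X assume X: "X \<in> psd_max_power d k"
  have "kron_list xs \<in> psd_min_power d k" if "length xs = k \<and> set xs \<subseteq> psd_mats d" for xs
    unfolding psd_min_power_def by (rule subsetD[OF mat_conv_subset]) (use that in blast)
  with X show "X \<in> blockpos d k"
    by (auto simp: psd_max_power_def dual_cone_def blockpos_def hermitian_mats_def)
qed

lemma mat_trace_mult:
  assumes "X \<in> carrier_mat n n" "Y \<in> carrier_mat n n"
  shows "mat_trace (X * Y) = (\<Sum>r<n. \<Sum>s<n. X $$ (r, s) * Y $$ (s, r))"
  using assms by (auto simp: mat_trace_def scalar_prod_def atLeast0LessThan intro!: sum.cong)

lemma mat_trace_carrier: "A \<in> carrier_mat n n \<Longrightarrow> mat_trace A = (\<Sum>i<n. A $$ (i, i))"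
  by (auto simp: mat_trace_def)

text \<open>The partial trace over the first factor of \<open>(p \<otimes> 1) X\<close>;
  \<open>ptrace\<close> below is the partial trace over the second factor.\<close>

definition slice :: "nat \<Rightarrow> nat \<Rightarrow> complex mat \<Rightarrow> complex mat \<Rightarrow> complex mat" where
  "slice d N p X = mat N N (\<lambda>(a, b). \<Sum>i<d. \<Sum>j<d. p $$ (j, i) * X $$ (i * N + a, j * N + b))"

definition ptrace :: "nat \<Rightarrow> nat \<Rightarrow> complex mat \<Rightarrow> complex mat" where
  "ptrace d N X = mat d d (\<lambda>(i, j). \<Sum>a<N. X $$ (i * N + a, j * N + a))"

lemma mat_trace_mult_kron:
  assumes X: "X \<in> carrier_mat (d * N) (d * N)" and p: "p \<in> carrier_mat d d" and Y: "Y \<in> carrier_mat N N"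
  shows "mat_trace (X * kron p Y) = mat_trace (slice d N p X * Y)"
proof -
  have "mat_trace (X * kron p Y) =
    (\<Sum>i<d. \<Sum>a<N. \<Sum>j<d. \<Sum>b<N. X $$ (i * N + a, j * N + b) * (p $$ (j, i) * Y $$ (b, a)))"
    using X p Y by (simp add: mat_trace_mult[of _ "d * N"] sum_mult_index kron_index'[OF p Y])
  \<comment> \<open>Fixing the two ranges orients the swap, so rewriting moves every sum over
    \<open>{..<d}\<close> inside and stops.\<close>
  also have "\<dots> = (\<Sum>a<N. \<Sum>b<N. \<Sum>i<d. \<Sum>j<d. X $$ (i * N + a, j * N + b) * (p $$ (j, i) * Y $$ (b, a)))"
    by (simp only: sum.swap[where A = "{..<d}" and B = "{..<N}"])
  also have "\<dots> = (\<Sum>a<N. \<Sum>b<N. slice d N p X $$ (a, b) * Y $$ (b, a))"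
    by (simp add: slice_def sum_distrib_left sum_distrib_right mult_ac)
  also have "\<dots> = mat_trace (slice d N p X * Y)"
    using Y by (intro mat_trace_mult[symmetric]) (auto simp: slice_def)
  finally show ?thesis .
qed

lemma slice_carrier [simp]: "slice d N p X \<in> carrier_mat N N"
  by (simp add: slice_def)

lemma ptrace_carrier [simp]: "ptrace d N X \<in> carrier_mat d d"
  by (simp add: ptrace_def)

text \<open>Contraction with \<open>p\<close> is adjoint to tensoring with \<open>p\<close>: testing
  the slice against \<open>xs\<close> is testing \<open>X\<close> against
  \<open>p # xs\<close>.\<close>

lemma slice_blockpos:
  assumes X: "X \<in> blockpos d (Suc k)" and p: "p \<in> psd_mats d"
  shows "slice d (d ^ k) p X \<in> blockpos d k"
proof -
  have "0 \<le> mat_trace (slice d (d ^ k) p X * kron_list xs)"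
    if xs: "length xs = k" "set xs \<subseteq> psd_mats d" for xs
  proof -
    have "0 \<le> mat_trace (X * kron_list (p # xs))"
      using X p xs unfolding blockpos_def by (auto dest!: spec[of _ "p # xs"])
    also have "\<dots> = mat_trace (slice d (d ^ k) p X * kron_list xs)"
      using X psd_carrier[OF p] kron_list_psd_carrier[OF xs(2,1)]
      by (simp add: blockpos_def mat_trace_mult_kron)
    finally show ?thesis .
  qed
  then show ?thesis by (simp add: blockpos_def)
qed

lemma trace_slice:
  "mat_trace (slice d N p X) = (\<Sum>i<d. \<Sum>j<d. p $$ (j, i) * ptrace d N X $$ (i, j))"
proof -
  have "mat_trace (slice d N p X) = (\<Sum>a<N. \<Sum>i<d. \<Sum>j<d. p $$ (j, i) * X $$ (i * N + a, j * N + a))"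
    by (simp add: mat_trace_carrier[OF slice_carrier]) (simp add: slice_def)
  also have "\<dots> = (\<Sum>i<d. \<Sum>j<d. \<Sum>a<N. p $$ (j, i) * X $$ (i * N + a, j * N + a))"
    by (simp only: sum.swap[where A = "{..<N}" and B = "{..<d}"])
  also have "\<dots> = (\<Sum>i<d. \<Sum>j<d. p $$ (j, i) * ptrace d N X $$ (i, j))"
    by (simp add: ptrace_def sum_distrib_left)
  finally show ?thesis .
qed

lemma trace_ptrace:
  "X \<in> carrier_mat (d * N) (d * N) \<Longrightarrow> mat_trace (ptrace d N X) = mat_trace X"
  by (simp add: mat_trace_carrier[of _ "d * N"] mat_trace_carrier[OF ptrace_carrier])
     (simp add: ptrace_def sum_mult_index)

lemma trace_slice_one:
  assumes "X \<in> carrier_mat (d * N) (d * N)"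
  shows "mat_trace (slice d N (1\<^sub>m d) X) = mat_trace X"
proof -
  have "mat_trace (slice d N (1\<^sub>m d) X) =
     (\<Sum>i<d. \<Sum>j<d. if j = i then ptrace d N X $$ (i, i) else 0)"
    unfolding trace_slice by (intro sum.cong refl) auto
  also have "\<dots> = mat_trace (ptrace d N X)" by (simp add: mat_trace_carrier[OF ptrace_carrier])
  finally show ?thesis using trace_ptrace[OF assms] by simp
qed

text \<open>The quadratic form of the partial trace at \<open>v\<close> is the pairing of
  \<open>X\<close> with the product matrix
  \<open>rank1 d v \<otimes> 1 \<otimes> ... \<otimes> 1\<close>.\<close>

lemma ptrace_psd:
  assumes X: "X \<in> blockpos d (Suc k)"
  shows "ptrace d (d ^ k) X \<in> psd_mats d"
proof (rule psdI)
  fix v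
  have "0 \<le> mat_trace (X * kron_list (rank1 d v # replicate k (1\<^sub>m d)))"
    using X psd_rank1 psd_one unfolding blockpos_def
    by (auto dest!: spec[of _ "rank1 d v # replicate k (1\<^sub>m d)"])
  also have "\<dots> = mat_trace (slice d (d ^ k) (rank1 d v) X)"
    using X psd_carrier[OF psd_rank1[of d v]]
    by (simp add: kron_list_replicate_one mat_trace_mult_kron[where d = d and N = "d ^ k"] blockpos_def right_mult_one_mat[OF slice_carrier])
  also have "\<dots> = qform d (ptrace d (d ^ k) X) v"
    by (simp add: trace_slice qform_def rank1_def mult_ac)
  finally show "0 \<le> qform d (ptrace d (d ^ k) X) v" .
qed simp

section \<open>Entrywise description of tensor products of maps\<close>

text \<open>Linearity in the shape in which \<open>map_tensor\<close> meets it: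
  \<open>map_tensor\<close> sees a map only through its values on matrix units, and this recovers
  the value at any matrix from them.\<close>

definition entry_linear :: "nat \<Rightarrow> (complex mat \<Rightarrow> complex mat) \<Rightarrow> bool" where
  "entry_linear N G \<longleftrightarrow> (\<forall>Y\<in>carrier_mat N N. G Y \<in> carrier_mat N N \<and>
     (\<forall>a<N. \<forall>b<N. G Y $$ (a, b) = (\<Sum>p<N. \<Sum>q<N. Y $$ (p, q) * G (mat_unit N p q) $$ (a, b))))"

lemma mat_unit_carrier [simp]: "mat_unit N i j \<in> carrier_mat N N"
  by (simp add: mat_unit_def)

lemma sum_delta2:
  fixes f :: "nat \<Rightarrow> nat \<Rightarrow> 'a::comm_monoid_add"
  assumes "i < m" "j < n"
  shows "(\<Sum>i'<m. \<Sum>j'<n. if i' = i \<and> j' = j then f i' j' else 0) = f i j"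
proof -
  have "(\<Sum>i'<m. \<Sum>j'<n. if i' = i \<and> j' = j then f i' j' else 0) =
    (\<Sum>i'<m. if i' = i then (\<Sum>j'<n. if j' = j then f i' j' else 0) else 0)"
    by (intro sum.cong refl) auto
  then show ?thesis using assms by simp
qed

lemma mult_index_inj:
  "a < N \<Longrightarrow> b < N \<Longrightarrow> i * N + a = j * N + b \<longleftrightarrow> i = j \<and> a = (b::nat)"
  by (metis add.commute div_mult_self1_is_m div_mult_self3 less_nat_zero_code add_cancel_right_left div_less mod_less mod_mult_self3)

text \<open>No linearity of \<open>F\<close> or \<open>G\<close> enters: \<open>map_tensor\<close>
  is an explicit linear combination of the entries of \<open>X\<close>, whose coefficients are its
  values on matrix units.\<close>

lemma entry_linear_map_tensor: "entry_linear (m * n) (map_tensor m n F G)"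
proof -
  have unit: "map_tensor m n F G (mat_unit (m * n) (i * n + p) (j * n + q)) $$ (r, s) =
     kron (F (mat_unit m i j)) (G (mat_unit n p q)) $$ (r, s)"
    if "i < m" "j < m" "p < n" "q < n" "r < m * n" "s < m * n" for i j p q r s
  proof -
    have "map_tensor m n F G (mat_unit (m * n) (i * n + p) (j * n + q)) $$ (r, s) =
      (\<Sum>i'<m. \<Sum>j'<m. \<Sum>p'<n. \<Sum>q'<n. if i' = i \<and> j' = j \<and> p' = p \<and> q' = q
         then kron (F (mat_unit m i' j')) (G (mat_unit n p' q')) $$ (r, s) else 0)"
      using that by (simp add: map_tensor_def)
         (intro sum.cong refl, auto simp: mat_unit_def mult_index_less mult_index_inj)
    also have "\<dots> = (\<Sum>i'<m. \<Sum>j'<m. if i' = i \<and> j' = j then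
       (\<Sum>p'<n. \<Sum>q'<n. if p' = p \<and> q' = q then kron (F (mat_unit m i' j')) (G (mat_unit n p' q')) $$ (r, s) else 0) else 0)"
      by (intro sum.cong refl) auto
    also have "\<dots> = kron (F (mat_unit m i j)) (G (mat_unit n p q)) $$ (r, s)"
      using that by (simp add: sum_delta2)
    finally show ?thesis .
  qed
  show ?thesis unfolding entry_linear_def
  proof (intro ballI conjI allI impI)
    fix Y :: "complex mat" and r s assume rs: "r < m * n" "s < m * n"
    have "map_tensor m n F G Y $$ (r, s) =
      (\<Sum>i<m. \<Sum>j<m. \<Sum>p<n. \<Sum>q<n. Y $$ (i * n + p, j * n + q) *
         map_tensor m n F G (mat_unit (m * n) (i * n + p) (j * n + q)) $$ (r, s))"
      using rs by (simp add: unit) (simp add: map_tensor_def)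
    also have "\<dots> = (\<Sum>i<m. \<Sum>p<n. \<Sum>j<m. \<Sum>q<n. Y $$ (i * n + p, j * n + q) *
         map_tensor m n F G (mat_unit (m * n) (i * n + p) (j * n + q)) $$ (r, s))"
      by (rule sum.cong[OF refl], rule sum.swap)
    finally show "map_tensor m n F G Y $$ (r, s) = (\<Sum>p<m * n. \<Sum>q<m * n. Y $$ (p, q) *
         map_tensor m n F G (mat_unit (m * n) p q) $$ (r, s))"
      by (simp add: sum_mult_index)
  qed (simp add: map_tensor_def)
qed

lemma entry_linear_map_tensor_power: "entry_linear (d ^ k) (map_tensor_power d P k)"
proof (cases k)
  case 0
  then show ?thesis by (auto simp: entry_linear_def mat_unit_def)
next
  case (Suc n)
  then show ?thesis using entry_linear_map_tensor[of d "d ^ n"] by simp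
qed

text \<open>If \<open>P = \<Sum> c_l Tr(p_l .) q_l\<close>, then \<open>P \<otimes> G\<close> sends
  \<open>X\<close> to \<open>\<Sum> c_l q_l \<otimes> G(X_l)\<close> with \<open>X_l\<close> the
  slice by \<open>p_l\<close>. The index order \<open>(j, i)\<close> comes from
  \<open>Tr(p E_ij) = p_ji\<close>.\<close>

lemma map_tensor_entry:
  fixes c :: "nat \<Rightarrow> complex"
  assumes P: "\<And>i j. i < d \<Longrightarrow> j < d \<Longrightarrow> P (mat_unit d i j) \<in> carrier_mat d d"
    and dec: "\<And>i j r s. i < d \<Longrightarrow> j < d \<Longrightarrow> r < d \<Longrightarrow> s < d \<Longrightarrow>
       P (mat_unit d i j) $$ (r, s) = (\<Sum>l\<in>L. c l * p l $$ (j, i) * q l $$ (r, s))"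
    and G: "entry_linear N G" and rs: "r < d * N" "s < d * N"
  shows "map_tensor d N P G X $$ (r, s) =
     (\<Sum>l\<in>L. c l * q l $$ (r div N, s div N) * G (slice d N (p l) X) $$ (r mod N, s mod N))"
proof -
  define g where "g a b = G (mat_unit N a b) $$ (r mod N, s mod N)" for a b
  define h where "h l = c l * q l $$ (r div N, s div N)" for l
  note ds = div_less_mod_less[OF rs(1)] div_less_mod_less[OF rs(2)]
  have Gc: "G Y \<in> carrier_mat N N" if "Y \<in> carrier_mat N N" for Y
    using G that by (auto simp: entry_linear_def)
  have "map_tensor d N P G X $$ (r, s) = (\<Sum>i<d. \<Sum>j<d. \<Sum>a<N. \<Sum>b<N.
      X $$ (i * N + a, j * N + b) * ((\<Sum>l\<in>L. h l * p l $$ (j, i)) * g a b))"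
    using rs ds by (simp add: map_tensor_def kron_index[OF P Gc] dec g_def h_def mult_ac)
  also have "\<dots> = (\<Sum>i<d. \<Sum>j<d. \<Sum>a<N. \<Sum>b<N. \<Sum>l\<in>L. h l * (p l $$ (j, i) * X $$ (i * N + a, j * N + b) * g a b))"
    by (simp add: sum_distrib_left sum_distrib_right mult_ac)
  also have "\<dots> = (\<Sum>l\<in>L. \<Sum>i<d. \<Sum>j<d. \<Sum>a<N. \<Sum>b<N. h l * (p l $$ (j, i) * X $$ (i * N + a, j * N + b) * g a b))"
    by (simp only: sum.swap[where B = L])
  also have "\<dots> = (\<Sum>l\<in>L. h l * G (slice d N (p l) X) $$ (r mod N, s mod N))"
  proof (rule sum.cong[OF refl])
    fix l
    let ?f = "\<lambda>i j a b. h l * (p l $$ (j, i) * X $$ (i * N + a, j * N + b) * g a b)"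
    have "(\<Sum>i<d. \<Sum>j<d. \<Sum>a<N. \<Sum>b<N. ?f i j a b) = (\<Sum>a<N. \<Sum>b<N. \<Sum>i<d. \<Sum>j<d. ?f i j a b)"
      by (simp only: sum.swap[where A = "{..<d}" and B = "{..<N}"])
    also have "\<dots> = h l * (\<Sum>a<N. \<Sum>b<N. slice d N (p l) X $$ (a, b) * g a b)"
      by (simp add: slice_def sum_distrib_left sum_distrib_right mult_ac)
    also have "\<dots> = h l * G (slice d N (p l) X) $$ (r mod N, s mod N)"
      unfolding g_def
      by (rule arg_cong[OF G[unfolded entry_linear_def, rule_format, OF slice_carrier, THEN conjunct2, rule_format, symmetric]])
         (use ds in auto)
    finally show "(\<Sum>i<d. \<Sum>j<d. \<Sum>a<N. \<Sum>b<N. ?f i j a b) = h l * G (slice d N (p l) X) $$ (r mod N, s mod N)" .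
  qed
  finally show ?thesis by (simp add: h_def)
qed

section \<open>The map\<close>

definition corner :: "nat \<Rightarrow> complex mat \<Rightarrow> complex mat" where
  "corner d X = mat d d (\<lambda>(r, s). if r < 2 \<and> s < 2 then X $$ (r, s) else 0)"

definition corner_map :: "nat \<Rightarrow> real \<Rightarrow> complex mat \<Rightarrow> complex mat" where
  "corner_map d e X = mat_trace X \<cdot>\<^sub>m 1\<^sub>m d + complex_of_real (1 + e) \<cdot>\<^sub>m corner d X"

lemma corner_carrier [simp]: "corner d X \<in> carrier_mat d d"
  by (simp add: corner_def)

lemma corner_map_carrier [simp]: "corner_map d e X \<in> carrier_mat d d"
  by (simp add: corner_map_def)

lemma mat_trace_add:
  "A \<in> carrier_mat n n \<Longrightarrow> B \<in> carrier_mat n n \<Longrightarrow> mat_trace (A + B) = mat_trace A + mat_trace B"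
  by (simp add: mat_trace_carrier[of _ n] sum.distrib)

lemma mat_trace_smult: "A \<in> carrier_mat n n \<Longrightarrow> mat_trace (c \<cdot>\<^sub>m A) = c * mat_trace A"
  by (simp add: mat_trace_carrier[of _ n] sum_distrib_left)

lemma linear_corner_map: "linear_mat_map d (corner_map d e)"
proof -
  have add: "corner_map d e (A + B) = corner_map d e A + corner_map d e B"
    if "A \<in> carrier_mat d d" "B \<in> carrier_mat d d" for A B
    using that
    by (intro eq_matI) (auto simp: corner_map_def corner_def mat_trace_add ring_distribs)
  have smult: "corner_map d e (c \<cdot>\<^sub>m A) = c \<cdot>\<^sub>m corner_map d e A"
    if "A \<in> carrier_mat d d" for c A
    using that
    by (intro eq_matI) (auto simp: corner_map_def corner_def mat_trace_smult ring_distribs)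
  have "corner_map d e \<in> LinearCombinations.module_hom class_ring (module_mat TYPE(complex) d d) (module_mat TYPE(complex) d d)"
    by (auto simp: LinearCombinations.module_hom_def matrix_vs_simps add smult)
  then show ?thesis
    unfolding linear_mat_map_def linear_map_def mod_hom_def mod_hom_axioms_def
    using matrix_vs[where 'a = complex] by (simp add: vectorspace.axioms(1))
qed

text \<open>Compression to the first two coordinates amounts to truncating the test vector.\<close>

lemma corner_psd:
  assumes "X \<in> psd_mats d"
  shows "corner d X \<in> psd_mats d"
proof (rule psdI)
  fix v
  have "qform d (corner d X) v = qform d X (\<lambda>i. if i < 2 then v i else 0)"
    unfolding qform_def by (intro sum.cong refl) (auto simp: corner_def)
  then show "0 \<le> qform d (corner d X) v" using psd_qform[OF assms] by metis
qed simp

text \<open>In the \<open>2 \<times> 2\<close> corner the difference is the adjugate of the corner of \<open>X\<close>.\<close>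

lemma trace_minus_corner_psd:
  assumes X: "X \<in> psd_mats d" and d: "d \<ge> 2"
  shows "mat_trace X \<cdot>\<^sub>m 1\<^sub>m d - corner d X \<in> psd_mats d"
proof -
  define W where "W = mat d d (\<lambda>(r, s). if r = 0 \<and> s = 0 then X $$ (1, 1) else if r = 1 \<and> s = 1 then X $$ (0, 0)
     else if r = 0 \<and> s = 1 then - X $$ (0, 1) else if r = 1 \<and> s = 0 then - X $$ (1, 0) else 0)"
  have W: "W \<in> psd_mats d"
  proof (rule psdI)
    fix v
    have "qform d W v = qform d W (\<lambda>i. if i < 2 then v i else 0)"
      unfolding qform_def by (intro sum.cong refl) (auto simp: W_def)
    \<comment> \<open>The adjugate at \<open>(v_0, v_1)\<close> has the same form value as
      \<open>X\<close> at \<open>(cnj v_1, - cnj v_0)\<close>.\<close>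
    also have "\<dots> = qform d X (\<lambda>i. if i = 0 then cnj (v 1) else if i = 1 then - cnj (v 0) else 0)"
      using d by (simp add: qform_supp2[of 0 d 1] W_def)
    finally show "0 \<le> qform d W v" using psd_qform[OF X] by metis
  qed (simp add: W_def)
  define t where "t = (\<Sum>i = 2..<d. X $$ (i, i))"
  have tr: "mat_trace X = X $$ (0, 0) + X $$ (1, 1) + t"
  proof -
    have "{..<d} = insert 0 (insert 1 {2..<d})" using d by auto
    then show ?thesis using psd_carrier[OF X] by (simp add: mat_trace_carrier t_def add.assoc)
  qed
  have nonneg: "0 \<le> t" "0 \<le> X $$ (0, 0) + X $$ (1, 1)"
    using psd_diag_nonneg[OF X] d unfolding t_def
    by (auto intro!: sum_nonneg simp: less_eq_complex_def)
  \<comment> \<open>\<open>W\<close> is the corner trace times the corner identity minus the corner.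
    The projection supplies the corner trace on the remaining diagonal, and \<open>t\<close> is the
    trace outside the corner.\<close>
  have "mat_trace X \<cdot>\<^sub>m 1\<^sub>m d - corner d X =
     t \<cdot>\<^sub>m 1\<^sub>m d + (X $$ (0, 0) + X $$ (1, 1)) \<cdot>\<^sub>m diag_proj d {2..} + W"
    using d by (intro eq_matI) (auto simp: tr corner_def diag_proj_def W_def less_2_cases_iff)
  also have "\<dots> \<in> psd_mats d"
    by (intro psd_add psd_smult psd_one psd_diag_proj W nonneg)
  finally show ?thesis .
qed

text \<open>The vectors \<open>e\<^sub>0 + i\<^sup>l e\<^sub>1\<close>, \<open>l < 4\<close>, produce \<open>Tr (B X) B\<close> plus the off-diagonal part of \<open>B X B\<close>;
  the indices \<open>4 \<le> l < 8\<close> complete this to \<open>P\<^sub>0\<close>, and index 8 stands for the subtracted map \<open>Tr(\<cdot>) 1\<close>.\<close>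

definition phase :: "nat \<Rightarrow> nat \<Rightarrow> complex" where
  "phase l r = (if r = 0 then 1 else if r = 1 then \<i> ^ l else 0)"

definition left_op :: "nat \<Rightarrow> nat \<Rightarrow> complex mat" where
  "left_op d l = (if l < 4 then rank1 d (phase l) else if l < 8 then
     diag_proj d ([{0}, {1}, {..<2}, {2..}] ! (l - 4)) else 1\<^sub>m d)"

text \<open>Halving the vector gives weight 1/4, an average over four phases. Indices 4 and 5 add
  the diagonal of \<open>B X B\<close>, index 6 adds \<open>Tr(B X) (1 - B)\<close>, and index 7
  adds \<open>Tr((1 - B) X) 1\<close>.\<close>

definition right_op :: "nat \<Rightarrow> nat \<Rightarrow> complex mat" where
  "right_op d l = (if l < 4 then rank1 d (\<lambda>r. phase l r / 2) else if l < 8 then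
     diag_proj d ([{0}, {1}, {2..}, UNIV] ! (l - 4)) else 1\<^sub>m d)"

lemma left_op_psd: "left_op d l \<in> psd_mats d"
  and right_op_psd: "right_op d l \<in> psd_mats d"
  by (auto simp: left_op_def right_op_def psd_rank1 psd_diag_proj psd_one)

text \<open>For indices in the corner the phase exponent \<open>j - i + r - s\<close> lies between
  -2 and 2, so the average over \<open>l < 4\<close> vanishes unless \<open>j + r = i + s\<close>.
  The remaining cases are \<open>i = j, r = s\<close> and \<open>i = r, j = s\<close>; their overlap
  is counted once, and indices 4 and 5 supply the second count.\<close>

lemma sum_left_right_op:
  assumes "i < d" "j < d" "r < d" "s < d"
  shows "(\<Sum>l<8. left_op d l $$ (j, i) * right_op d l $$ (r, s)) =
    (if r = s \<and> i = j then 1 else 0) + (if r < 2 \<and> s < 2 \<and> r = i \<and> s = j then 1 else 0)"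
proof -
  have c: "x = 0 \<or> x = 1 \<or> x \<ge> 2" for x :: nat by linarith
  have sum8: "(\<Sum>l<8. f l) = f 0 + f 1 + f 2 + f 3 + f 4 + f 5 + f 6 + f 7" for f :: "nat \<Rightarrow> complex"
    by (simp add: eval_nat_numeral add.assoc)
  show ?thesis unfolding sum8
    using c[of i] c[of j] c[of r] c[of s] assms
    by (elim disjE) (simp_all add: left_op_def right_op_def rank1_def diag_proj_def phase_def power3_eq_cube)
qed

lemma trace_mat_unit:
  assumes "i < d"
  shows "mat_trace (mat_unit d i j) = (if i = j then 1 else 0)"
proof -
  have "mat_trace (mat_unit d i j) = (\<Sum>x<d. if x = i then (if i = j then 1 else 0) else 0)"
    unfolding mat_trace_carrier[OF mat_unit_carrier] by (intro sum.cong) (auto simp: mat_unit_def)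
  then show ?thesis using assms by simp
qed

text \<open>The trace term has coefficient \<open>1 + e\<close> in the first eight summands; index
  8, with both operators the identity and weight \<open>- e\<close>, brings it back to 1.\<close>

lemma corner_map_unit_entry:
  assumes "i < d" "j < d" "r < d" "s < d"
  shows "corner_map d e (mat_unit d i j) $$ (r, s) =
    (\<Sum>l\<le>8. (if l < 8 then complex_of_real (1 + e) else - complex_of_real e) * left_op d l $$ (j, i) * right_op d l $$ (r, s))"
proof -
  have "{..8} = insert 8 {..<8::nat}" by auto
  then have "(\<Sum>l\<le>8. (if l < 8 then complex_of_real (1 + e) else - complex_of_real e) * left_op d l $$ (j, i) * right_op d l $$ (r, s))
    = - complex_of_real e * (if i = j then 1 else 0) * (if r = s then 1 else 0) +
      complex_of_real (1 + e) * (\<Sum>l<8. left_op d l $$ (j, i) * right_op d l $$ (r, s))"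
    using assms by (simp add: left_op_def right_op_def sum_distrib_left mult.assoc)
  moreover have "corner_map d e (mat_unit d i j) $$ (r, s) = (if i = j then 1 else 0) * (if r = s then 1 else 0)
     + complex_of_real (1 + e) * (if r < 2 \<and> s < 2 then mat_unit d i j $$ (r, s) else 0)"
    using assms by (simp add: corner_map_def corner_def trace_mat_unit)
  moreover have "mat_unit d i j $$ (r, s) = (if r = i \<and> s = j then 1 else 0)"
    using assms by (simp add: mat_unit_def)
  ultimately show ?thesis
    by (simp only: sum_left_right_op[OF assms]) (auto simp: algebra_simps)
qed

section \<open>Failure of entanglement breaking\<close>

text \<open>Nonnegativity of a principal 2 by 2 minor. The vectors \<open>(- m z, 1)\<close> with
  real \<open>m\<close> turn positivity into a quadratic inequality in \<open>m\<close>.\<close>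

lemma psd_offdiag_bound:
  assumes A: "A \<in> psd_mats n" and n: "n \<ge> 2"
  shows "(cmod (A $$ (0, 1)))\<^sup>2 \<le> Re (A $$ (0, 0)) * Re (A $$ (1, 1))"
proof -
  let ?a = "Re (A $$ (0, 0))" and ?b = "Re (A $$ (1, 1))" and ?z = "A $$ (0, 1)"
  have q: "0 \<le> ?a * (m\<^sup>2 * (cmod ?z)\<^sup>2) + ?b - 2 * (m * (cmod ?z)\<^sup>2)" for m :: real
  proof -
    have "0 \<le> Re (qform n A (\<lambda>i. if i = 0 then - ?z * of_real m else if i = 1 then 1 else 0))"
      using psd_qform[OF A] by (simp add: less_eq_complex_def)
    also have "\<dots> = Re (A $$ (0, 0) * complex_of_real (m\<^sup>2) * (?z * cnj ?z)
        - complex_of_real m * (?z * cnj ?z) - complex_of_real m * (A $$ (1, 0) * ?z) + A $$ (1, 1))"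
      using n by (simp add: qform_supp2[of 0 n 1] power2_eq_square mult_ac)
    also have "A $$ (1, 0) * ?z = ?z * cnj ?z" using psd_hermitian[OF A, of 0 1] n by simp
    also have "?z * cnj ?z = complex_of_real ((cmod ?z)\<^sup>2)" by (rule complex_norm_square[symmetric])
    finally show ?thesis by simp
  qed
  have a: "0 \<le> ?a" using psd_diag_nonneg[OF A, of 0] n by (simp add: less_eq_complex_def)
  define y where "y = (cmod ?z)\<^sup>2"
  have y: "0 \<le> y" by (simp add: y_def)
  show ?thesis
  proof (cases "?a = 0")
    case True
    have "y = 0"
    proof (rule ccontr)
      assume "y \<noteq> 0"
      \<comment> \<open>With \<open>a = 0\<close> the inequality is linear in \<open>m\<close>, and
        this \<open>m\<close> would give \<open>b + 1 \<le> b\<close>.\<close>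
      have "2 * ((?b + 1) / (2 * y) * y) \<le> ?b"
        using q[of "(?b + 1) / (2 * y)"] True by (simp add: y_def)
      then show False using \<open>y \<noteq> 0\<close> by simp
    qed
    then show ?thesis using True by (simp add: y_def)
  next
    case False
    then have "?a > 0" using a by simp
    \<comment> \<open>The value \<open>m = 1 / a\<close> minimizes the quadratic.\<close>
    have "0 \<le> ?a * ((1 / ?a)\<^sup>2 * y) + ?b - 2 * (1 / ?a * y)"
      using q[of "1 / ?a"] unfolding y_def .
    also have "\<dots> = ?b - y / ?a" using False by (simp add: power2_eq_square)
    finally have "y / ?a \<le> ?b" by simp
    then show ?thesis using \<open>?a > 0\<close> by (simp add: pos_divide_le_eq y_def mult.commute)
  qed
qed

text \<open>The quadratic form of the partial transpose at \<open>e\<^sub>0 \<otimes> e\<^sub>1 - e\<^sub>1 \<otimes> e\<^sub>0\<close>.\<close>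

definition swap_witness :: "nat \<Rightarrow> complex mat \<Rightarrow> real" where
  "swap_witness d Z = Re (Z $$ (1, 1) + Z $$ (d, d) - Z $$ (d + 1, 0) - Z $$ (0, d + 1))"

text \<open>The witness is real-linear, so product matrices suffice. There it equals
  \<open>x_00 y_11 + x_11 y_00 - 2 Re(x_01 y_01)\<close>, and the two minors bound the last term.
  Indices 1, \<open>d\<close> and \<open>d + 1\<close> stand for \<open>e_0 \<otimes> e_1\<close>,
  \<open>e_1 \<otimes> e_0\<close> and \<open>e_1 \<otimes> e_1\<close>.\<close>

lemma swap_witness_nonneg:
  assumes Z: "Z \<in> psd_min_tensor 2 d" and d: "d \<ge> 2"
  shows "0 \<le> swap_witness d Z"
proof -
  let ?T = "{Z \<in> carrier_mat (2 * d) (2 * d). 0 \<le> swap_witness d Z}"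
  have "mat_convex ?T"
    unfolding mat_convex_def
  proof (intro ballI allI impI)
    fix A B and u v :: real
    assume *: "A \<in> ?T" "B \<in> ?T" "0 \<le> u" "0 \<le> v" "u + v = 1"
    have "(complex_of_real u \<cdot>\<^sub>m A + complex_of_real v \<cdot>\<^sub>m B) $$ (i, j) = u * A $$ (i, j) + v * B $$ (i, j)"
      if "i < 2 * d" "j < 2 * d" for i j
      using * that by auto
    then have "swap_witness d (complex_of_real u \<cdot>\<^sub>m A + complex_of_real v \<cdot>\<^sub>m B) =
       u * swap_witness d A + v * swap_witness d B"
      using d by (simp add: swap_witness_def algebra_simps)
    then show "complex_of_real u \<cdot>\<^sub>m A + complex_of_real v \<cdot>\<^sub>m B \<in> ?T" using * by simp
  qed
  moreover have "{kron x y | x y. x \<in> psd_mats 2 \<and> y \<in> psd_mats d} \<subseteq> ?T"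
  proof safe
    fix x y assume x: "x \<in> psd_mats 2" and y: "y \<in> psd_mats d"
    note c = psd_carrier[OF x] psd_carrier[OF y]
    show "kron x y \<in> carrier_mat (2 * d) (2 * d)" using c by simp
    let ?p = "Re (x $$ (0, 0)) * Re (y $$ (1, 1))" and ?q = "Re (x $$ (1, 1)) * Re (y $$ (0, 0))"
    have im: "Im (x $$ (0, 0)) = 0" "Im (x $$ (1, 1)) = 0" "Im (y $$ (0, 0)) = 0" "Im (y $$ (1, 1)) = 0"
      and re: "0 \<le> Re (x $$ (0, 0))" "0 \<le> Re (x $$ (1, 1))" "0 \<le> Re (y $$ (0, 0))" "0 \<le> Re (y $$ (1, 1))"
      using psd_diag_nonneg[OF x] psd_diag_nonneg[OF y] d by (auto simp: less_eq_complex_def)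
    have "kron x y $$ (1, 1) = x $$ (0, 0) * y $$ (1, 1)" "kron x y $$ (d, d) = x $$ (1, 1) * y $$ (0, 0)"
      "kron x y $$ (d + 1, 0) = x $$ (1, 0) * y $$ (1, 0)" "kron x y $$ (0, d + 1) = x $$ (0, 1) * y $$ (0, 1)"
      using kron_index'[OF c, of 0 0 1 1] kron_index'[OF c, of 1 1 0 0]
        kron_index'[OF c, of 1 0 1 0] kron_index'[OF c, of 0 1 0 1] d by auto
    moreover have "x $$ (1, 0) = cnj (x $$ (0, 1))" "y $$ (1, 0) = cnj (y $$ (0, 1))"
      using psd_hermitian[OF x, of 0 1] psd_hermitian[OF y, of 0 1] d by simp_all
    moreover define t where "t = Re (x $$ (0, 1) * y $$ (0, 1))"
    ultimately have w: "swap_witness d (kron x y) = ?p + ?q - 2 * t"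
      using im by (simp add: swap_witness_def)
    have "(cmod (x $$ (0, 1)) * cmod (y $$ (0, 1)))\<^sup>2 \<le>
      (Re (x $$ (0, 0)) * Re (x $$ (1, 1))) * (Re (y $$ (0, 0)) * Re (y $$ (1, 1)))"
      unfolding power_mult_distrib
      by (intro mult_mono psd_offdiag_bound[OF x] psd_offdiag_bound[OF y d] mult_nonneg_nonneg re
          zero_le_power2 order_refl)
    \<comment> \<open>The left side is \<open>p q\<close>, so this is the inequality of arithmetic
      and geometric means.\<close>
    also have "\<dots> \<le> ((?p + ?q) / 2)\<^sup>2"
      using zero_le_power2[of "?p - ?q"] by (simp add: power2_eq_square field_simps)
    finally have "cmod (x $$ (0, 1)) * cmod (y $$ (0, 1)) \<le> (?p + ?q) / 2"
      by (rule power2_le_imp_le) (intro divide_nonneg_nonneg add_nonneg_nonneg mult_nonneg_nonneg re, simp)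
    moreover have "t \<le> cmod (x $$ (0, 1)) * cmod (y $$ (0, 1))"
      using complex_Re_le_cmod[of "x $$ (0, 1) * y $$ (0, 1)"] by (simp only: t_def norm_mult)
    ultimately have "t \<le> (?p + ?q) / 2" by (rule order_trans[rotated])
    then show "0 \<le> swap_witness d (kron x y)" by (simp add: w)
  qed
  ultimately show ?thesis
    using mat_conv_minimal[of _ ?T] Z unfolding psd_min_tensor_def by blast
qed

text \<open>The case \<open>n = 2\<close> suffices: the unnormalized maximally entangled matrix
  \<open>\<Omega>\<close> on the first two basis vectors has an image with negative witness.\<close>

lemma not_entanglement_breaking_corner_map:
  assumes d: "d \<ge> 2" and e: "e > 0"
  shows "\<not> entanglement_breaking d (corner_map d e)"
proof
  assume eb: "entanglement_breaking d (corner_map d e)"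
  define \<Omega> where "\<Omega> = rank1 (2 * d) (\<lambda>r. if r = 0 \<or> r = d + 1 then 1 else 0)"
  define Z where "Z = map_tensor 2 d (\<lambda>X. X) (corner_map d e) \<Omega>"
  have "\<Omega> \<in> psd_mats (2 * d)" by (simp add: \<Omega>_def psd_rank1)
  then have "Z \<in> psd_min_tensor 2 d"
    using eb unfolding entanglement_breaking_def Z_def by (auto dest!: spec[of _ 2])
  then have nonneg: "0 \<le> swap_witness d Z" by (rule swap_witness_nonneg[OF _ d])
  have v: "(i * d + p = 0 \<or> i * d + p = d + 1) \<longleftrightarrow> p = i" if "i < 2" "p < d" for i p
  proof -
    from \<open>i < 2\<close> have "i = 0 \<or> i = 1" by linarith
    then show ?thesis using that(2) d by (elim disjE; simp; linarith?)
  qed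
  have \<Omega>: "\<Omega> $$ (i * d + p, j * d + q) = (if p = i \<and> q = j then 1 else 0)"
    if "i < 2" "j < 2" "p < d" "q < d" for i j p q
    using that v[of i p] v[of j q] mult_index_less[of i 2 p d] mult_index_less[of j 2 q d]
    by (simp add: \<Omega>_def rank1_def)
  \<comment> \<open>\<open>Z\<close> is a Choi matrix: its block \<open>(i, j)\<close> is the image
    of the matrix unit \<open>E_ij\<close>.\<close>
  have Z: "Z $$ (i * d + p, j * d + q) = corner_map d e (mat_unit d i j) $$ (p, q)"
    if ij: "i < 2" "j < 2" "p < d" "q < d" for i j p q
  proof -
    have "Z $$ (i * d + p, j * d + q) = (\<Sum>i'<2. \<Sum>j'<2. \<Sum>p'<d. \<Sum>q'<d.
       if p' = i' \<and> q' = j' then mat_unit 2 i' j' $$ (i, j) * corner_map d e (mat_unit d p' q') $$ (p, q) else 0)"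
      unfolding Z_def map_tensor_def
        index_mat(1)[OF mult_index_less[OF ij(1,3)] mult_index_less[OF ij(2,4)]] prod.case
        kron_index'[OF mat_unit_carrier corner_map_carrier ij]
    proof (intro sum.cong[OF refl])
      fix i' j' p' q' :: nat
      assume "i' \<in> {..<2}" "j' \<in> {..<2}" "p' \<in> {..<d}" "q' \<in> {..<d}"
      then have "\<Omega> $$ (i' * d + p', j' * d + q') = (if p' = i' \<and> q' = j' then 1 else 0)"
        by (intro \<Omega>) simp_all
      then show "\<Omega> $$ (i' * d + p', j' * d + q') * (mat_unit 2 i' j' $$ (i, j) * corner_map d e (mat_unit d p' q') $$ (p, q)) =
        (if p' = i' \<and> q' = j' then mat_unit 2 i' j' $$ (i, j) * corner_map d e (mat_unit d p' q') $$ (p, q) else 0)"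
        by simp
    qed
    also have "\<dots> = (\<Sum>i'<2. \<Sum>j'<2. mat_unit 2 i' j' $$ (i, j) * corner_map d e (mat_unit d i' j') $$ (p, q))"
      by (rule sum.cong[OF refl], rule sum.cong[OF refl], rule sum_delta2) (use d in auto)
    also have "\<dots> = (\<Sum>i'<2. \<Sum>j'<2. if i' = i \<and> j' = j then corner_map d e (mat_unit d i' j') $$ (p, q) else 0)"
      using ij by (intro sum.cong refl) (auto simp: mat_unit_def)
    also have "\<dots> = corner_map d e (mat_unit d i j) $$ (p, q)" using ij(1,2) by (rule sum_delta2)
    finally show ?thesis .
  qed
  \<comment> \<open>The diagonal entries come from the trace term alone, the off-diagonal ones from
    the corner term alone.\<close>
  have "Z $$ (1, 1) = 1" "Z $$ (d, d) = 1" "Z $$ (d + 1, 0) = 1 + e" "Z $$ (0, d + 1) = 1 + e"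
    using Z[of 0 0 1 1] Z[of 1 1 0 0] Z[of 1 0 1 0] Z[of 0 1 0 1] d
    by (simp_all add: corner_map_def corner_def trace_mat_unit) (simp_all add: mat_unit_def)
  then have "swap_witness d Z = - 2 * e" by (simp add: swap_witness_def)
  then show False using nonneg e by simp
qed

section \<open>Two-sided bounds for the tensor powers\<close>

text \<open>The trace of a slice by \<open>p\<close> is \<open>Tr(p X')\<close> with
  \<open>X'\<close> the partial trace of \<open>X\<close>, so the sum is the map with
  \<open>e = 0\<close> applied to \<open>X'\<close>.\<close>

lemma sum_trace_slice_right_op:
  assumes X: "X \<in> carrier_mat (d * N) (d * N)" and rs: "r < d" "s < d"
  shows "(\<Sum>l<8. mat_trace (slice d N (left_op d l) X) * right_op d l $$ (r, s)) =
     (if r = s then mat_trace X else 0) + corner d (ptrace d N X) $$ (r, s)"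
proof -
  let ?X = "ptrace d N X"
  have "(\<Sum>l<8. mat_trace (slice d N (left_op d l) X) * right_op d l $$ (r, s)) =
    (\<Sum>l<8. \<Sum>i<d. \<Sum>j<d. left_op d l $$ (j, i) * right_op d l $$ (r, s) * ?X $$ (i, j))"
    by (simp add: trace_slice sum_distrib_left sum_distrib_right mult_ac)
  also have "\<dots> = (\<Sum>i<d. \<Sum>j<d. \<Sum>l<8. left_op d l $$ (j, i) * right_op d l $$ (r, s) * ?X $$ (i, j))"
    by (simp only: sum.swap[where A = "{..<8}" and B = "{..<d}"])
  also have "\<dots> = (\<Sum>i<d. \<Sum>j<d. (if j = i then (if r = s then ?X $$ (i, i) else 0) else 0)) +
     (\<Sum>i<d. \<Sum>j<d. if i = r \<and> j = s then (if r < 2 \<and> s < 2 then ?X $$ (r, s) else 0) else 0)"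
    unfolding sum.distrib[symmetric] sum_distrib_right[symmetric]
    by (intro sum.cong refl) (use rs in \<open>auto simp: sum_left_right_op\<close>)
  also have "(\<Sum>i<d. \<Sum>j<d. (if j = i then (if r = s then ?X $$ (i, i) else 0) else 0)) = (if r = s then mat_trace ?X else 0)"
    by (simp add: mat_trace_carrier[OF ptrace_carrier])
  also have "(\<Sum>i<d. \<Sum>j<d. if i = r \<and> j = s then (if r < 2 \<and> s < 2 then ?X $$ (r, s) else 0) else 0)
     = corner d ?X $$ (r, s)"
    using rs by (simp add: sum_delta2 corner_def)
  finally show ?thesis using trace_ptrace[OF X] by simp
qed

lemma map_tensor_corner_map_entry:
  assumes "entry_linear N G" "r < d * N" "s < d * N"
  shows "map_tensor d N (corner_map d e) G X $$ (r, s) =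
    complex_of_real (1 + e) * (\<Sum>l<8. right_op d l $$ (r div N, s div N) * G (slice d N (left_op d l) X) $$ (r mod N, s mod N))
    - complex_of_real e * (1\<^sub>m d $$ (r div N, s div N) * G (slice d N (1\<^sub>m d) X) $$ (r mod N, s mod N))"
proof -
  have "{..8} = insert 8 {..<8::nat}" by auto
  moreover have "map_tensor d N (corner_map d e) G X $$ (r, s) = (\<Sum>l\<le>8.
     (if l < 8 then complex_of_real (1 + e) else - complex_of_real e) * right_op d l $$ (r div N, s div N)
       * G (slice d N (left_op d l) X) $$ (r mod N, s mod N))"
    by (rule map_tensor_entry[where p = "left_op d" and q = "right_op d",
          OF corner_map_carrier corner_map_unit_entry assms])
  ultimately show ?thesis
    by (simp add: sum_distrib_left mult.assoc left_op_def[of d 8] right_op_def[of d 8])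
qed

lemma entry_linear_carrier: "entry_linear N G \<Longrightarrow> Y \<in> carrier_mat N N \<Longrightarrow> G Y \<in> carrier_mat N N"
  unfolding entry_linear_def by blast

lemma sep_one: "1\<^sub>m (d ^ k) \<in> sep d k"
  using sep_generator[of "replicate k (1\<^sub>m d)" k d] psd_one
  by (simp add: kron_list_replicate_one set_replicate_conv_if)

text \<open>The common shape of both bounds: \<open>A l\<close> and \<open>B\<close> come from the
  induction hypothesis, and \<open>C\<close> collects the multiples of the identity left over on the
  last \<open>k\<close> factors.\<close>

lemma sep_combine:
  fixes m :: nat
  assumes A: "\<And>l. l < m \<Longrightarrow> A l \<in> sep d k" and q: "\<And>l. l < m \<Longrightarrow> q l \<in> psd_mats d"
    and B: "B \<in> sep d k" and C: "C \<in> psd_mats d"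
    and H: "H \<in> carrier_mat (d ^ Suc k) (d ^ Suc k)"
    and entry: "\<And>r s. r < d * d ^ k \<Longrightarrow> s < d * d ^ k \<Longrightarrow> H $$ (r, s) =
      (\<Sum>l<m. q l $$ (r div d ^ k, s div d ^ k) * A l $$ (r mod d ^ k, s mod d ^ k)) +
      1\<^sub>m d $$ (r div d ^ k, s div d ^ k) * B $$ (r mod d ^ k, s mod d ^ k) +
      C $$ (r div d ^ k, s div d ^ k) * 1\<^sub>m (d ^ k) $$ (r mod d ^ k, s mod d ^ k)"
  shows "H \<in> sep d (Suc k)"
proof -
  let ?S = "mat (d ^ Suc k) (d ^ Suc k) (\<lambda>(r, s). \<Sum>l<m. kron (q l) (A l) $$ (r, s))"
  note c = psd_carrier[OF q] sep_carrier[OF A] sep_carrier[OF B] psd_carrier[OF C]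
  have "?S + kron (1\<^sub>m d) B + kron C (1\<^sub>m (d ^ k)) \<in> sep d (Suc k)"
    by (intro sep_add sep_sum sep_kron psd_one A q B C sep_one) auto
  moreover have "H = ?S + kron (1\<^sub>m d) B + kron C (1\<^sub>m (d ^ k))"
  proof (rule eq_matI)
    have dim: "kron C (1\<^sub>m (d ^ k)) \<in> carrier_mat (d * d ^ k) (d * d ^ k)"
      "kron (1\<^sub>m d) B \<in> carrier_mat (d * d ^ k) (d * d ^ k)" using c by simp_all
    fix r s assume "r < dim_row (?S + kron (1\<^sub>m d) B + kron C (1\<^sub>m (d ^ k)))"
      "s < dim_col (?S + kron (1\<^sub>m d) B + kron C (1\<^sub>m (d ^ k)))"
    then have rs: "r < d * d ^ k" "s < d * d ^ k" using dim by auto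
    have "(\<Sum>l<m. kron (q l) (A l) $$ (r, s)) =
      (\<Sum>l<m. q l $$ (r div d ^ k, s div d ^ k) * A l $$ (r mod d ^ k, s mod d ^ k))"
      using rs by (intro sum.cong[OF refl] kron_index[OF c(1,2)]) auto
    then show "H $$ (r, s) = (?S + kron (1\<^sub>m d) B + kron C (1\<^sub>m (d ^ k))) $$ (r, s)"
      using rs dim kron_index[OF one_carrier_mat c(3) rs] kron_index[OF c(4) one_carrier_mat rs]
      by (simp add: entry[OF rs])
  qed (use H psd_carrier[OF C] in \<open>auto simp: kron_def\<close>)
  ultimately show ?thesis by simp
qed

lemma one_kron_entry:
  assumes "r < d * N" "s < d * N"
  shows "(1\<^sub>m (d * N) $$ (r, s) :: complex) = 1\<^sub>m d $$ (r div N, s div N) * 1\<^sub>m N $$ (r mod N, s mod N)"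
proof -
  have "r = s \<longleftrightarrow> r div N = s div N \<and> r mod N = s mod N" by (metis div_mult_mod_eq)
  then show ?thesis using assms div_less_mod_less[OF assms(1)] div_less_mod_less[OF assms(2)] by auto
qed

text \<open>Both bounds are proved together because the summand with weight \<open>- e\<close>
  reverses the order: the lower bound needs the upper bound for the slice by the identity, and vice
  versa.\<close>

lemma corner_map_power_bounds:
  assumes d: "d \<ge> 2" and e: "0 \<le> e" "e * 4 ^ k \<le> 1" and X: "X \<in> blockpos d k"
  defines "G \<equiv> map_tensor_power d (corner_map d e)"
  shows "G k X - (complex_of_real (1 - e * 4 ^ k) * mat_trace X) \<cdot>\<^sub>m 1\<^sub>m (d ^ k) \<in> sep d k \<and>
    (complex_of_real (4 ^ k) * mat_trace X) \<cdot>\<^sub>m 1\<^sub>m (d ^ k) - G k X \<in> sep d k"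
  using e(2) X
proof (induction k arbitrary: X)
  \<comment> \<open>Here the tensor power is the identity on 1 by 1 matrices, and pairing with the
    empty product says that the single entry is nonnegative.\<close>
  case 0
  have X: "X \<in> carrier_mat 1 1" and pos: "0 \<le> mat_trace (X * kron_list [])"
    using 0 by (auto simp: blockpos_def)
  have tr: "mat_trace X = X $$ (0, 0)" using X by (simp add: mat_trace_carrier[of _ 1])
  have pos: "0 \<le> X $$ (0, 0)" using pos X by (simp add: tr)
  have "G 0 X - (complex_of_real (1 - e * 4 ^ 0) * mat_trace X) \<cdot>\<^sub>m 1\<^sub>m (d ^ 0) =
     (complex_of_real e * X $$ (0, 0)) \<cdot>\<^sub>m 1\<^sub>m (d ^ 0)"
    using X by (intro eq_matI) (auto simp: tr G_def algebra_simps)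
  moreover have "(complex_of_real (4 ^ 0) * mat_trace X) \<cdot>\<^sub>m 1\<^sub>m (d ^ 0) - G 0 X = 0\<^sub>m (d ^ 0) (d ^ 0)"
    using X by (intro eq_matI) (auto simp: tr G_def)
  moreover have "0 \<le> complex_of_real e * X $$ (0, 0)"
    using e(1) pos by (simp add: less_eq_complex_def)
  ultimately show ?case using sep_smult[OF sep_one] sep.zero by metis
next
  case (Suc k)
  define N where "N = d ^ k"
  define Y where "Y p = slice d N p X" for p
  define c where "c = 1 - e * 4 ^ k"
  define C :: real where "C = 4 ^ k"
  define T where "T = mat_trace X"
  have "e * 4 ^ k \<le> e * 4 ^ Suc k" using e(1) by (intro mult_left_mono) auto
  then have ek: "e * 4 ^ k \<le> 1" using Suc.prems(1) by linarith
  have c: "0 \<le> c" and C: "1 \<le> C" "e * C \<le> 1" using ek by (simp_all add: c_def C_def)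
  have "e * 1 \<le> e * C" using C(1) e(1) by (intro mult_left_mono)
  then have e1: "e \<le> 1" using C by simp
  have X: "X \<in> carrier_mat (d * N) (d * N)" using Suc.prems(2) by (simp add: blockpos_def N_def)
  have Y: "Y p \<in> blockpos d k" if "p \<in> psd_mats d" for p
    using slice_blockpos[OF Suc.prems(2) that] by (simp add: Y_def N_def)
  define lo where "lo p = G k (Y p) - (complex_of_real c * mat_trace (Y p)) \<cdot>\<^sub>m 1\<^sub>m N" for p
  define up where "up p = (complex_of_real C * mat_trace (Y p)) \<cdot>\<^sub>m 1\<^sub>m N - G k (Y p)" for p
  have lo: "lo p \<in> sep d k" and up: "up p \<in> sep d k" if "p \<in> psd_mats d" for p
    using Suc.IH[OF ek Y[OF that]] by (auto simp: lo_def up_def c_def C_def N_def)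
  have lin: "entry_linear N (G k)" unfolding G_def N_def by (rule entry_linear_map_tensor_power)
  have GY: "G k (Y p) \<in> carrier_mat N N" for p
    unfolding Y_def by (rule entry_linear_carrier[OF lin slice_carrier])
  \<comment> \<open>Traces of slices depend on \<open>X\<close> only through \<open>X'\<close>, so
    the remainder \<open>C\<close> is a condition on one positive matrix of size
    \<open>d\<close>.\<close>
  define X' where "X' = ptrace d N X"
  have X': "X' \<in> psd_mats d" using ptrace_psd[OF Suc.prems(2)] by (simp add: X'_def N_def)
  have trX': "mat_trace X' = T" using trace_ptrace[OF X] by (simp add: X'_def T_def)
  have T: "0 \<le> T" unfolding trX'[symmetric] mat_trace_carrier[OF psd_carrier[OF X']]
    by (intro complex_sum_nonneg psd_diag_nonneg[OF X']) simp
  have trY1: "mat_trace (Y (1\<^sub>m d)) = T" using trace_slice_one[OF X] by (simp add: Y_def T_def)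
  have GS: "G (Suc k) X \<in> carrier_mat (d ^ Suc k) (d ^ Suc k)"
    unfolding G_def using Suc.prems(2)
    by (intro entry_linear_carrier[OF entry_linear_map_tensor_power]) (simp add: blockpos_def)
  have entry: "G (Suc k) X $$ (r, s) =
    complex_of_real (1 + e) * (\<Sum>l<8. right_op d l $$ (r div N, s div N) * G k (Y (left_op d l)) $$ (r mod N, s mod N))
    - complex_of_real e * (1\<^sub>m d $$ (r div N, s div N) * G k (Y (1\<^sub>m d)) $$ (r mod N, s mod N))"
    if "r < d * N" "s < d * N" for r s
    using map_tensor_corner_map_entry[OF lin that] by (simp add: G_def N_def Y_def)
  have sums: "(\<Sum>l<8. mat_trace (Y (left_op d l)) * right_op d l $$ (r, s)) = T * 1\<^sub>m d $$ (r, s) + corner d X' $$ (r, s)"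
    if "r < d" "s < d" for r s
    using sum_trace_slice_right_op[OF X that] that by (simp add: Y_def T_def X'_def)
  have e1c: "0 \<le> complex_of_real (1 + e)" and ec: "0 \<le> complex_of_real e"
    using e(1) by (simp_all add: less_eq_complex_def)
  have loe: "lo p $$ (a, b) = G k (Y p) $$ (a, b) - complex_of_real c * mat_trace (Y p) * 1\<^sub>m N $$ (a, b)"
    and upe: "up p $$ (a, b) = complex_of_real C * mat_trace (Y p) * 1\<^sub>m N $$ (a, b) - G k (Y p) $$ (a, b)"
    if "a < N" "b < N" for p a b
    using that GY[of p] by (auto simp: lo_def up_def)
  define K where "K = corner d X'"
  have Kc: "K \<in> carrier_mat d d" by (simp add: K_def)
  have N: "d ^ k = N" "d ^ Suc k = d * N" by (simp_all add: N_def)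
  define Q where "Q = 1 - e * 4 ^ Suc k"
  have lower: "G (Suc k) X - (complex_of_real Q * T) \<cdot>\<^sub>m 1\<^sub>m (d ^ Suc k) \<in> sep d (Suc k)"
  \<comment> \<open>Replacing each \<open>G k (Y p)\<close> by its bound leaves
    \<open>(1 + e) c (T 1 + K) - e C T 1 - Q T 1\<close> on the first factor; this is the matrix
    given as \<open>C\<close>.\<close>
  proof (rule sep_combine[where m = 8 and q = "right_op d" and A = "\<lambda>l. complex_of_real (1 + e) \<cdot>\<^sub>m lo (left_op d l)"
      and B = "complex_of_real e \<cdot>\<^sub>m up (1\<^sub>m d)"
      and C = "(complex_of_real ((1 + e) * c - e * C - Q) * T) \<cdot>\<^sub>m 1\<^sub>m d + complex_of_real ((1 + e) * c) \<cdot>\<^sub>m K"])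
    \<comment> \<open>The factor 4 in \<open>Q\<close> pays for the losses \<open>e C\<close> from
      \<open>c\<close> and \<open>e C\<close> from the subtracted summand.\<close>
    have "(1 + e) * c - e * C - Q = e + e * C * (2 - e)"
      by (simp add: c_def C_def Q_def algebra_simps)
    also have "\<dots> \<ge> 0" using e(1) e1 C(1) by simp
    finally have "0 \<le> complex_of_real ((1 + e) * c - e * C - Q) * T"
      using T by (intro complex_mult_nonneg) (simp_all add: less_eq_complex_def)
    moreover have "0 \<le> complex_of_real ((1 + e) * c)" using c e(1) by (simp add: less_eq_complex_def)
    ultimately show "(complex_of_real ((1 + e) * c - e * C - Q) * T) \<cdot>\<^sub>m 1\<^sub>m d
         + complex_of_real ((1 + e) * c) \<cdot>\<^sub>m K \<in> psd_mats d"
      unfolding K_def by (intro psd_add psd_smult psd_one corner_psd X')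
  next
    fix r s assume "r < d * d ^ k" "s < d * d ^ k"
    then have rs: "r < d * N" "s < d * N" by (simp_all add: N_def)
    note ds = div_less_mod_less[OF rs(1)] div_less_mod_less[OF rs(2)]
    let ?R = "\<lambda>l. right_op d l $$ (r div N, s div N)" and ?g = "\<lambda>p. G k (Y p) $$ (r mod N, s mod N)"
      and ?d1 = "1\<^sub>m d $$ (r div N, s div N) :: complex" and ?d2 = "1\<^sub>m N $$ (r mod N, s mod N) :: complex"
    have "(complex_of_real (1 + e) \<cdot>\<^sub>m lo (left_op d l)) $$ (r mod N, s mod N) =
        complex_of_real (1 + e) * (?g (left_op d l) - complex_of_real c * mat_trace (Y (left_op d l)) * ?d2)" for l
      using ds sep_carrier[OF lo[OF left_op_psd[of d l]]] loe[OF ds(2,4)] by (simp add: N)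
    then have "(\<Sum>l<8. ?R l * (complex_of_real (1 + e) \<cdot>\<^sub>m lo (left_op d l)) $$ (r mod N, s mod N)) =
      (\<Sum>l<8. complex_of_real (1 + e) * (?R l * ?g (left_op d l)) -
      complex_of_real (1 + e) * complex_of_real c * ?d2 * (mat_trace (Y (left_op d l)) * ?R l))"
      by (simp only:) (simp add: algebra_simps)
    also have "\<dots> = complex_of_real (1 + e) * (\<Sum>l<8. ?R l * ?g (left_op d l)) -
      complex_of_real (1 + e) * complex_of_real c * ?d2 * (T * ?d1 + K $$ (r div N, s div N))"
      by (simp only: sum_subtractf sum_distrib_left[symmetric] sums[OF ds(1,3)] K_def)
    finally have A: "(\<Sum>l<8. ?R l * (complex_of_real (1 + e) \<cdot>\<^sub>m lo (left_op d l)) $$ (r mod N, s mod N)) = \<dots>" .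
    have B: "(complex_of_real e \<cdot>\<^sub>m up (1\<^sub>m d)) $$ (r mod N, s mod N) =
        complex_of_real e * (complex_of_real C * T * ?d2 - ?g (1\<^sub>m d))"
      using ds sep_carrier[OF up[OF psd_one]] upe[OF ds(2,4)] by (simp add: N trY1)
    have D: "((complex_of_real ((1 + e) * c - e * C - Q) * T) \<cdot>\<^sub>m 1\<^sub>m d + complex_of_real ((1 + e) * c) \<cdot>\<^sub>m K)
       $$ (r div N, s div N) = complex_of_real ((1 + e) * c - e * C - Q) * T * ?d1 + complex_of_real ((1 + e) * c) * K $$ (r div N, s div N)"
      using ds Kc by simp
    have E: "(G (Suc k) X - (complex_of_real Q * T) \<cdot>\<^sub>m 1\<^sub>m (d * N)) $$ (r, s) =
       G (Suc k) X $$ (r, s) - complex_of_real Q * T * (?d1 * ?d2)"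
      unfolding one_kron_entry[OF rs, symmetric] using rs GS by (simp add: N)
    show "(G (Suc k) X - (complex_of_real Q * T) \<cdot>\<^sub>m 1\<^sub>m (d ^ Suc k)) $$ (r, s) =
      (\<Sum>l<8. right_op d l $$ (r div d ^ k, s div d ^ k) * (complex_of_real (1 + e) \<cdot>\<^sub>m lo (left_op d l)) $$ (r mod d ^ k, s mod d ^ k)) +
      1\<^sub>m d $$ (r div d ^ k, s div d ^ k) * (complex_of_real e \<cdot>\<^sub>m up (1\<^sub>m d)) $$ (r mod d ^ k, s mod d ^ k) +
      ((complex_of_real ((1 + e) * c - e * C - Q) * T) \<cdot>\<^sub>m 1\<^sub>m d + complex_of_real ((1 + e) * c) \<cdot>\<^sub>m K)
        $$ (r div d ^ k, s div d ^ k) * 1\<^sub>m (d ^ k) $$ (r mod d ^ k, s mod d ^ k)"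
      unfolding N A B D E entry[OF rs] by (simp add: algebra_simps del: index_one_mat)
  qed (use GS lo up left_op_psd right_op_psd psd_one e1c ec in \<open>auto intro!: sep_smult\<close>)
  have upper: "(complex_of_real (4 * C) * T) \<cdot>\<^sub>m 1\<^sub>m (d ^ Suc k) - G (Suc k) X \<in> sep d (Suc k)"
  \<comment> \<open>The remainder is \<open>4 C T 1 - (1 + e) C (T 1 + K)\<close>. Since
    \<open>K \<le> T 1\<close> and \<open>e \<le> 1\<close>, the factor 4 is enough.\<close>
  proof (rule sep_combine[where m = 8 and q = "right_op d" and A = "\<lambda>l. complex_of_real (1 + e) \<cdot>\<^sub>m up (left_op d l)"
      and B = "complex_of_real e \<cdot>\<^sub>m (lo (1\<^sub>m d) + (complex_of_real c * T) \<cdot>\<^sub>m 1\<^sub>m N)"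
      and C = "(complex_of_real (C * (2 - 2 * e)) * T) \<cdot>\<^sub>m 1\<^sub>m d + complex_of_real ((1 + e) * C) \<cdot>\<^sub>m (T \<cdot>\<^sub>m 1\<^sub>m d - K)"])
    have "0 \<le> complex_of_real (C * (2 - 2 * e)) * T"
      using T C(1) e1 by (intro complex_mult_nonneg) (simp_all add: less_eq_complex_def)
    moreover have "0 \<le> complex_of_real ((1 + e) * C)" using C(1) e(1) by (simp add: less_eq_complex_def)
    moreover have "T \<cdot>\<^sub>m 1\<^sub>m d - K \<in> psd_mats d"
      using trace_minus_corner_psd[OF X' d] by (simp add: K_def trX')
    ultimately show "(complex_of_real (C * (2 - 2 * e)) * T) \<cdot>\<^sub>m 1\<^sub>m d
        + complex_of_real ((1 + e) * C) \<cdot>\<^sub>m (T \<cdot>\<^sub>m 1\<^sub>m d - K) \<in> psd_mats d"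
      by (intro psd_add psd_smult psd_one)
    have "1\<^sub>m N \<in> sep d k" unfolding N(1)[symmetric] by (rule sep_one)
    then show "complex_of_real e \<cdot>\<^sub>m (lo (1\<^sub>m d) + (complex_of_real c * T) \<cdot>\<^sub>m 1\<^sub>m N) \<in> sep d k"
      using c T ec lo[OF psd_one]
      by (intro sep_smult sep_add complex_mult_nonneg) (simp_all add: less_eq_complex_def)
  next
    fix r s assume "r < d * d ^ k" "s < d * d ^ k"
    then have rs: "r < d * N" "s < d * N" by (simp_all add: N_def)
    note ds = div_less_mod_less[OF rs(1)] div_less_mod_less[OF rs(2)]
    let ?R = "\<lambda>l. right_op d l $$ (r div N, s div N)" and ?g = "\<lambda>p. G k (Y p) $$ (r mod N, s mod N)"
      and ?d1 = "1\<^sub>m d $$ (r div N, s div N) :: complex" and ?d2 = "1\<^sub>m N $$ (r mod N, s mod N) :: complex"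
    have "(complex_of_real (1 + e) \<cdot>\<^sub>m up (left_op d l)) $$ (r mod N, s mod N) =
        complex_of_real (1 + e) * (complex_of_real C * mat_trace (Y (left_op d l)) * ?d2 - ?g (left_op d l))" for l
      using ds sep_carrier[OF up[OF left_op_psd[of d l]]] upe[OF ds(2,4)] by (simp add: N)
    then have "(\<Sum>l<8. ?R l * (complex_of_real (1 + e) \<cdot>\<^sub>m up (left_op d l)) $$ (r mod N, s mod N)) =
      (\<Sum>l<8. complex_of_real (1 + e) * complex_of_real C * ?d2 * (mat_trace (Y (left_op d l)) * ?R l) -
       complex_of_real (1 + e) * (?R l * ?g (left_op d l)))"
      by (simp only:) (simp add: algebra_simps)
    also have "\<dots> = complex_of_real (1 + e) * complex_of_real C * ?d2 * (T * ?d1 + K $$ (r div N, s div N)) -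
      complex_of_real (1 + e) * (\<Sum>l<8. ?R l * ?g (left_op d l))"
      by (simp only: sum_subtractf sum_distrib_left[symmetric] sums[OF ds(1,3)] K_def)
    finally have A: "(\<Sum>l<8. ?R l * (complex_of_real (1 + e) \<cdot>\<^sub>m up (left_op d l)) $$ (r mod N, s mod N)) = \<dots>" .
    have B: "(complex_of_real e \<cdot>\<^sub>m (lo (1\<^sub>m d) + (complex_of_real c * T) \<cdot>\<^sub>m 1\<^sub>m N)) $$ (r mod N, s mod N) =
        complex_of_real e * ?g (1\<^sub>m d)"
      using ds sep_carrier[OF lo[OF psd_one]] loe[OF ds(2,4)] by (simp add: N trY1)
    have D: "((complex_of_real (C * (2 - 2 * e)) * T) \<cdot>\<^sub>m 1\<^sub>m d + complex_of_real ((1 + e) * C) \<cdot>\<^sub>m (T \<cdot>\<^sub>m 1\<^sub>m d - K))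
       $$ (r div N, s div N) = complex_of_real (C * (2 - 2 * e)) * T * ?d1 + complex_of_real ((1 + e) * C) * (T * ?d1 - K $$ (r div N, s div N))"
      using ds Kc by simp
    have E: "((complex_of_real (4 * C) * T) \<cdot>\<^sub>m 1\<^sub>m (d * N) - G (Suc k) X) $$ (r, s) =
       complex_of_real (4 * C) * T * (?d1 * ?d2) - G (Suc k) X $$ (r, s)"
      unfolding one_kron_entry[OF rs, symmetric] using rs GS by (simp add: N)
    show "((complex_of_real (4 * C) * T) \<cdot>\<^sub>m 1\<^sub>m (d ^ Suc k) - G (Suc k) X) $$ (r, s) =
      (\<Sum>l<8. right_op d l $$ (r div d ^ k, s div d ^ k) * (complex_of_real (1 + e) \<cdot>\<^sub>m up (left_op d l)) $$ (r mod d ^ k, s mod d ^ k)) +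
      1\<^sub>m d $$ (r div d ^ k, s div d ^ k) * (complex_of_real e \<cdot>\<^sub>m (lo (1\<^sub>m d) + (complex_of_real c * T) \<cdot>\<^sub>m 1\<^sub>m N)) $$ (r mod d ^ k, s mod d ^ k) +
      ((complex_of_real (C * (2 - 2 * e)) * T) \<cdot>\<^sub>m 1\<^sub>m d + complex_of_real ((1 + e) * C) \<cdot>\<^sub>m (T \<cdot>\<^sub>m 1\<^sub>m d - K))
        $$ (r div d ^ k, s div d ^ k) * 1\<^sub>m (d ^ k) $$ (r mod d ^ k, s mod d ^ k)"
      unfolding N A B D E entry[OF rs] by (simp add: algebra_simps del: index_one_mat)
  qed (use GS up left_op_psd right_op_psd e1c in \<open>auto intro!: sep_smult\<close>)
  show ?case using lower upper by (simp add: T_def Q_def C_def)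
qed

theorem proposition1p4:
  fixes k d :: nat
  assumes "k \<ge> 1" and "d \<ge> 2"
  shows "\<exists>P. linear_mat_map d P \<and> \<not> entanglement_breaking d P \<and> entanglement_annihilating k d P"
proof -
  \<comment> \<open>This choice makes \<open>1 - e * 4 ^ k\<close> zero, so the lower bound says
    that the image itself lies in \<open>sep d k\<close>.\<close>
  define e :: real where "e = 1 / 4 ^ k"
  have e: "0 < e" "e * 4 ^ k = 1" by (simp_all add: e_def)
  have "entanglement_annihilating k d (corner_map d e)"
    unfolding entanglement_annihilating_def
  proof (rule image_subsetI)
    fix X assume "X \<in> psd_max_power d k"
    then have X: "X \<in> blockpos d k" using psd_max_power_subset_blockpos by blast
    let ?G = "map_tensor_power d (corner_map d e) k X"
    have "?G - (complex_of_real (1 - e * 4 ^ k) * mat_trace X) \<cdot>\<^sub>m 1\<^sub>m (d ^ k) \<in> sep d k"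
      using corner_map_power_bounds[OF assms(2) _ _ X, of e] e by simp
    moreover have "?G - (complex_of_real (1 - e * 4 ^ k) * mat_trace X) \<cdot>\<^sub>m 1\<^sub>m (d ^ k) = ?G"
      using entry_linear_carrier[OF entry_linear_map_tensor_power, of X d k "corner_map d e"] X e
      by (intro eq_matI) (auto simp: blockpos_def)
    ultimately show "?G \<in> psd_min_power d k" using sep_subset_psd_min_power[OF assms(1)] by auto
  qed
  then show ?thesis
    using linear_corner_map not_entanglement_breaking_corner_map[OF assms(2) e(1)] by blast
qed

end
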